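(* Let $\phi(z)=e^{\psi(z)}$, $z\in\mathbb{R}$, be the characteristic function of an infinitely divisible distribution on $\mathbb{R}$ with cumulant function $$\psi(z)=i\gamma z-\tfrac12\sigma^2z^2+\int_{\mathbb{R}}\left(e^{izx}-1-izx\,h(x)\right)U(dx),$$ where $h$ is a truncation function and $U$ is the Lévy measure. Let $$\hat\rho(z)=\int_{-1}^{1}\log\frac{\phi(z)}{\phi(z+\lambda)}\,d\lambda-\tfrac13\sigma^2,\qquad z\in\mathbb{R},$$ and let $B=[a,b]$, where $-\infty<a<b<\infty$ and $U(\{a\}\cup\{b\})=0$. Then: (i) $$\int_B\left(\frac{x-\sin x}{x}\right)U(dx)=\frac{1}{4\pi}\,\mathrm{v.p.}\int_{\mathbb{R}}\hat\rho(z)\left(\int_B e^{-izx}\,dx\right)dz.$$ (ii) If $\int_{|x|>1}x^2\,U(dx)<\infty$, then $$\int_B x^2\,U(dx)=-\frac{1}{2\pi}\,\mathrm{v.p.}\int_{\mathbb{R}}\left(\psi''(z)+\sigma^2\right)\left(\int_B e^{-izx}\,dx\right)dz.$$ (iii) If $\int_{\mathbb{R}}|\hat\rho(z)|\,dz<\infty$, then the Lévy measure $U$ is absolutely continuous with respect to the Lebesgue measure, has a bounded continuous density $u(x)$, and $$u(x)=\frac{x}{x-\sin x}\cdot\frac{1}{4\pi}\int_{\mathbb{R}}e^{-izx}\hat\rho(z)\,dz.$$ (iv) If $\int_{|x|>1}x^2\,U(dx)<\infty$ and $\int_{\mathbb{R}}|\psi''(z)+\sigma^2|\,dz<\infty$,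 then the Lévy measure $U$ is absolutely continuous with respect to the Lebesgue measure, has a bounded continuous density $u(x)$, and $$u(x)=-\frac{1}{2\pi x^2}\int_{\mathbb{R}}e^{-izx}\left(\psi''(z)+\sigma^2\right)dz.$$
   Context: Here $\gamma\in\mathbb{R}$ and $\sigma\ge 0$. A Lévy measure $U$ is a Borel measure on $\mathbb{R}$ with $U(\{0\})=0$ and $\int_{\mathbb{R}}\min(1,x^2)\,U(dx)<\infty$. A truncation function is a bounded Borel measurable function $h:\mathbb{R}\to\mathbb{R}$ with $h(x)=1+o(x)$ as $x\to0$ and $h(x)=O(1/x)$ as $|x|\to\infty$. The logarithm is the continuous (distinguished) one, i.e. $\log\phi(z)=\psi(z)$ and $\log\frac{\phi(z)}{\phi(z+\lambda)}=\psi(z)-\psi(z+\lambda)$. The notation $\mathrm{v.p.}\int_{\mathbb{R}}g(z)\,dz$ means the principal value $\lim_{T\to\infty}\int_{-T}^{T}g(z)\,dz$. The function $(x-\sin x)/x$ is taken to be $0$ at $x=0$ (this is immaterial since $U(\{0\})=0$). The second derivative $\psi''$ exists when $\int_{|x|>1}x^2\,U(dx)<\infty$.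
   Formalization: In (iii) and (iv) the density u is claimed continuous on x≠0 and bounded on |x|≥ε for each ε>0, with the formula for x≠0; a bounded continuous density on all of ℝ is false in general, e.g. for U(dx)=x^{-2}e^{-x^2}dx, σ=0. *)

theory Defs
  imports "HOL-Probability.Probability"
begin

primrec conv_power :: "real measure \<Rightarrow> nat \<Rightarrow> real measure" where
  "conv_power Q 0 = return borel 0"
| "conv_power Q (Suc n) = convolution Q (conv_power Q n)"

definition infinitely_divisible :: "real measure \<Rightarrow> bool" where
  "infinitely_divisible P \<longleftrightarrow>
     real_distribution P \<and> (\<forall>n\<ge>1. \<exists>Q. real_distribution Q \<and> P = conv_power Q n)"

definition levy_measure :: "real measure \<Rightarrow> bool" where
  "levy_measure U \<longleftrightarrow> sets U = sets borel \<and> emeasure U {0} = 0 \<and>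
     (\<integral>\<^sup>+x. ennreal (min 1 (x\<^sup>2)) \<partial>U) < \<infinity>"

definition truncation_function :: "(real \<Rightarrow> real) \<Rightarrow> bool" where
  "truncation_function h \<longleftrightarrow> h \<in> borel_measurable borel \<and> bounded (range h) \<and>
     (\<lambda>x. h x - 1) \<in> o[at 0](\<lambda>x. x) \<and> h \<in> O[at_infinity](\<lambda>x. 1 / x)"

definition cumulant ::
  "real \<Rightarrow> real \<Rightarrow> (real \<Rightarrow> real) \<Rightarrow> real measure \<Rightarrow> real \<Rightarrow> complex" where
  "cumulant \<gamma> \<sigma> h U z =
     \<i> * of_real (\<gamma> * z) - of_real (\<sigma>\<^sup>2 * z\<^sup>2 / 2) +
     (LINT x|U. iexp (z * x) - 1 - \<i> * of_real (z * x * h x))"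

(* The increment psi z - psi (z + l) is the distinguished logarithm of phi z / phi (z + l)
   for phi = exp o psi. *)
definition rho_hat :: "(real \<Rightarrow> complex) \<Rightarrow> real \<Rightarrow> real \<Rightarrow> complex" where
  "rho_hat \<psi> \<sigma> z = (CLBINT l:{-1..1}. \<psi> z - \<psi> (z + l)) - of_real (\<sigma>\<^sup>2 / 3)"

definition second_derivative :: "(real \<Rightarrow> complex) \<Rightarrow> real \<Rightarrow> complex" where
  "second_derivative f z = vector_derivative (\<lambda>w. vector_derivative f (at w)) (at z)"

definition finite_second_moment_at_infinity :: "real measure \<Rightarrow> bool" where
  "finite_second_moment_at_infinity U \<longleftrightarrow>
     (\<integral>\<^sup>+x\<in>{x. \<bar>x\<bar> > 1}. ennreal (x\<^sup>2) \<partial>U) < \<infinity>"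

definition has_principal_value :: "(real \<Rightarrow> complex) \<Rightarrow> complex \<Rightarrow> bool" where
  "has_principal_value g L \<longleftrightarrow>
     (\<forall>T. set_integrable lborel {-T..T} g) \<and>
     ((\<lambda>T. CLBINT z:{-T..T}. g z) \<longlongrightarrow> L) at_top"

definition lebesgue_density :: "real measure \<Rightarrow> (real \<Rightarrow> real) \<Rightarrow> bool" where
  "lebesgue_density U u \<longleftrightarrow> u \<in> borel_measurable borel \<and> (\<forall>x. 0 \<le> u x) \<and>
     U = density lborel (\<lambda>x. ennreal (u x))"

(* Densities of Levy measures are considered on the punctured line only. They may be
   unbounded near the origin: for U(dx) = x^(-2) exp (-x^2) dx both rho_hat and
   psi'' + sigma^2 are integrable.  Boundedness therefore means boundedness off every
   neighbourhood of 0. *)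
definition bounded_continuous_off_zero :: "(real \<Rightarrow> real) \<Rightarrow> bool" where
  "bounded_continuous_off_zero u \<longleftrightarrow>
     continuous_on (- {0}) u \<and> (\<forall>\<epsilon>>0. bounded (u ` {x. \<epsilon> \<le> \<bar>x\<bar>}))"

end

theory Submission
  imports Defs
begin

text \<open>
  All four claims are Fourier inversion for two finite positive measures built from \<open>U\<close>.
  Integrating \<open>\<psi> z - \<psi> (z + l)\<close> over \<open>l\<close> in the symmetric interval \<open>[-1, 1]\<close> kills every term
  that is odd in \<open>l\<close>: the drift, the cross term of the Gaussian part, and the compensator
  \<open>i l x h x\<close>, so that neither \<open>\<gamma>\<close> nor \<open>h\<close> survives. The Gaussian part leaves \<open>\<sigma>\<^sup>2 / 3\<close>, which
  the definition of \<open>\<rho>\<close> subtracts. By Fubini \<open>\<rho>\<close> is the characteristic function of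
  \<open>w(x) U(dx)\<close> with \<open>w(x) = 2 (x - sin x) / x\<close> (\<open>rho_hat_cumulant\<close>). This weight is positive off
  the origin and at most \<open>4 min 1 (x\<^sup>2)\<close>, so the measure is finite. If \<open>U\<close> has a second moment,
  differentiating twice under the integral shows that \<open>- (\<psi>'' + \<sigma>\<^sup>2)\<close> is the characteristic
  function of \<open>x\<^sup>2 U(dx)\<close> (\<open>second_derivative_cumulant\<close>).

  Claims (i) and (ii) are Levy's inversion theorem for these two measures
  (\<open>char_principal_value\<close>); the inversion theorem for probability measures along integer
  cutoffs extends by normalisation and by the decay \<open>2 / \<bar>z\<bar>\<close> of the kernel of an interval.

  For (iii) and (iv) let \<open>M\<close> be a finite measure with integrable characteristic function. Then the
  limit in the inversion theorem is an absolutely convergent integral, and Fubini turns it into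
  \<open>M [a, b] = \<integral> f over [a, b]\<close> with \<open>f\<close> the inverse Fourier transform. Since \<open>f\<close> is bounded, \<open>M\<close>
  has no atoms, so this formula holds on every interval and \<open>f\<close> is the density of \<open>M\<close>
  (\<open>density_of_integrable_char\<close>). Dividing by the weight, which vanishes only at the \<open>U\<close>-null point
  0, gives the density of \<open>U\<close> (\<open>levy_density_of_integrable_char\<close>).
\<close>

section \<open>Fourier integrals and the kernel of an interval\<close>

lemma continuous_fourier_integral:
  fixes f :: "real \<Rightarrow> complex"
  assumes f: "integrable M f" and M: "sets M = sets borel"
  shows "continuous_on UNIV (\<lambda>t. CLINT x|M. iexp (t * x) * f x)"
proof (intro continuous_at_imp_continuous_on ballI)
  note [measurable_cong] = M
  have [measurable]: "f \<in> borel_measurable M" using f by auto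
  fix t :: real
  show "isCont (\<lambda>t. CLINT x|M. iexp (t * x) * f x) t"
    unfolding continuous_at_sequentially
  proof safe
    fix X assume X: "X \<longlonglongrightarrow> t"
    show "((\<lambda>t. CLINT x|M. iexp (t * x) * f x) \<circ> X) \<longlonglongrightarrow> (CLINT x|M. iexp (t * x) * f x)"
      unfolding comp_def
      by (rule integral_dominated_convergence[where w="\<lambda>x. norm (f x)"])
        (use f in \<open>auto intro!: tendsto_intros X simp: norm_mult simp del: of_real_mult\<close>)
  qed
qed

lemma norm_fourier_integral_le:
  fixes f :: "real \<Rightarrow> complex"
  shows "norm (CLINT x|M. iexp (t * x) * f x) \<le> (LINT x|M. norm (f x))"
proof -
  have "norm (CLINT x|M. iexp (t * x) * f x) \<le> (LINT x|M. norm (iexp (t * x) * f x))"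
    by (rule integral_norm_bound)
  then show ?thesis by (simp add: norm_mult del: of_real_mult)
qed

definition interval_kernel :: "real \<Rightarrow> real \<Rightarrow> real \<Rightarrow> complex" where
  "interval_kernel a b z = (CLBINT x:{a..b}. iexp (- (z * x)))"

lemma interval_kernel_eq:
  assumes "a \<le> b" "z \<noteq> 0"
  shows "interval_kernel a b z = (iexp (- (z * a)) - iexp (- (z * b))) / (\<i> * z)"
proof -
  have "interval_kernel a b z = (CLBINT x=a..b. iexp (- (z * x)))"
    using \<open>a \<le> b\<close> by (simp add: interval_kernel_def interval_integral_Icc)
  also have "\<dots> = (- iexp (- (z * b)) / (\<i> * z)) - (- iexp (- (z * a)) / (\<i> * z))"
    using assms
    by (intro interval_integral_FTC_finite)
      (auto intro!: derivative_eq_intros continuous_intros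
        simp: has_vector_derivative_complex_iff Re_exp Im_exp Re_divide Im_divide power2_eq_square field_simps)
  finally show ?thesis by (simp add: diff_divide_distrib)
qed

lemma norm_interval_kernel_le:
  assumes "a \<le> b"
  shows "norm (interval_kernel a b z) \<le> b - a"
proof -
  have "norm (interval_kernel a b z) \<le> (LBINT x:{a..b}. norm (iexp (- (z * x))))"
    unfolding interval_kernel_def
    by (intro set_integral_norm_bound borel_integrable_atLeastAtMost' continuous_intros)
  also have "\<dots> = b - a" using assms by (simp add: set_lebesgue_integral_def)
  finally show ?thesis .
qed

lemma norm_interval_kernel_decay:
  assumes "a \<le> b" "z \<noteq> 0"
  shows "norm (interval_kernel a b z) \<le> 2 / \<bar>z\<bar>"
proof -
  have "norm (iexp (- (z * a)) - iexp (- (z * b))) \<le> 2"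
    by (rule order_trans[OF norm_triangle_ineq4]) simp
  then show ?thesis
    using assms by (simp add: interval_kernel_eq norm_divide norm_mult divide_right_mono del: of_real_mult of_real_minus)
qed

lemma measurable_interval_kernel [measurable]:
  "interval_kernel a b \<in> borel_measurable borel"
  unfolding interval_kernel_def[abs_def] set_lebesgue_integral_def by measurable

section \<open>Fourier inversion for finite measures\<close>

lemma char_eq_fourier_integral: "char M = (\<lambda>t. CLINT x|M. iexp (t * x) * 1)"
  by (auto simp: char_def)

lemma continuous_char:
  assumes "finite_measure M" "sets M = sets borel"
  shows "continuous_on UNIV (char M)"
  unfolding char_eq_fourier_integral
  by (rule continuous_fourier_integral) (use assms in \<open>auto simp: finite_measure.integrable_const\<close>)

lemma norm_char_le:
  shows "norm (char M t) \<le> measure M (space M)"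
  using norm_fourier_integral_le[of M t "\<lambda>_. 1"] by (simp add: char_eq_fourier_integral)

text \<open>Levy's theorem gives the limit along integer cutoffs. Moving the cutoff from \<open>\<lfloor>T\<rfloor>\<close> to
  \<open>T\<close> adds two intervals of length at most 1 on which the integrand is at most \<open>C / \<lfloor>T\<rfloor>\<close>.\<close>

lemma tendsto_symmetric_integral_real:
  fixes g :: "real \<Rightarrow> complex"
  assumes int: "\<And>T. set_integrable lborel {-T..T} g"
    and decay: "\<And>z. z \<noteq> 0 \<Longrightarrow> norm (g z) \<le> C / \<bar>z\<bar>"
    and lim: "(\<lambda>n. CLBINT z:{- real n..real n}. g z) \<longlonglongrightarrow> L"
  shows "((\<lambda>T. CLBINT z:{-T..T}. g z) \<longlongrightarrow> L) at_top"
proof -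
  let ?G = "\<lambda>T. CLBINT z:{-T..T}. g z"
  let ?n = "\<lambda>T::real. nat \<lfloor>T\<rfloor>"
  have C: "0 \<le> C" using order_trans[OF norm_ge_zero decay[of 1]] by simp
  have step: "norm (?G T - ?G S) \<le> C / S * (2 * (T - S))" if "0 < S" "S \<le> T" for S T
  proof -
    let ?D = "{-T..T} - {-S..S}"
    have D: "set_integrable lborel ?D g" "set_integrable lborel ?D (\<lambda>_. C / S)"
      by (rule set_integrable_subset[OF int[of T]]; auto)
        (rule set_integrable_subset[OF borel_integrable_atLeastAtMost'[of "-T" T]]; auto)
    have "?G T = (CLBINT z:{-S..S} \<union> ?D. g z)"
      using that by (intro arg_cong[where f="\<lambda>A. CLBINT z:A. g z"]) auto
    also have "\<dots> = ?G S + (CLBINT z:?D. g z)"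
      using D int by (intro set_integral_Un) auto
    finally have "norm (?G T - ?G S) = norm (CLBINT z:?D. g z)" by simp
    also have "\<dots> \<le> (LBINT z:?D. norm (g z))"
      by (rule set_integral_norm_bound[OF D(1)])
    also have "\<dots> \<le> (LBINT z:?D. C / S)"
    proof (rule set_integral_mono)
      show "set_integrable lborel ?D (\<lambda>z. norm (g z))" using D(1) by (rule set_integrable_norm)
      fix z assume z: "z \<in> ?D"
      then have "S < \<bar>z\<bar>" by auto
      then have "norm (g z) \<le> C / \<bar>z\<bar>" "C / \<bar>z\<bar> \<le> C / S"
        using decay[of z] that C by (auto intro!: divide_left_mono)
      then show "norm (g z) \<le> C / S" by simp
    qed (rule D)
    also have "\<dots> = C / S * measure lborel ?D"
      by (simp add: set_lebesgue_integral_def)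
    also have "measure lborel ?D = 2 * (T - S)"
      using that by (subst measure_Diff) auto
    finally show ?thesis .
  qed
  have floor_top: "filterlim ?n sequentially at_top"
    unfolding filterlim_at_top
  proof
    fix N :: nat
    show "\<forall>\<^sub>F T in at_top. N \<le> ?n T"
      using eventually_ge_at_top[of "real N"] by eventually_elim linarith
  qed
  have "((\<lambda>T. ?G T - ?G (real (?n T))) \<longlongrightarrow> 0) at_top"
  proof (rule Lim_null_comparison)
    show "\<forall>\<^sub>F T in at_top. norm (?G T - ?G (real (?n T))) \<le> C / real (?n T) * 2"
    proof (rule eventually_mono[OF eventually_ge_at_top[of 1]])
      fix T :: real assume T: "1 \<le> T"
      have n: "0 < real (?n T)" "real (?n T) \<le> T" "T - real (?n T) \<le> 1"
        using T by linarith+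
      have "norm (?G T - ?G (real (?n T))) \<le> C / real (?n T) * (2 * (T - real (?n T)))"
        using n by (intro step)
      also have "\<dots> \<le> C / real (?n T) * 2"
        using n C by (intro mult_left_mono) auto
      finally show "norm (?G T - ?G (real (?n T))) \<le> C / real (?n T) * 2" .
    qed
    have "(\<lambda>n. C / real n * 2) \<longlonglongrightarrow> 0"
      using tendsto_mult[OF lim_const_over_n[of C] tendsto_const[of 2]] by simp
    from filterlim_compose[OF this floor_top]
    show "((\<lambda>T. C / real (?n T) * 2) \<longlongrightarrow> 0) at_top" .
  qed
  from tendsto_add[OF this filterlim_compose[OF lim floor_top]]
  show ?thesis by simp
qed

text \<open>Normalise \<open>M\<close> to a probability measure; the zero measure, for which this is impossible, is
  trivial.\<close>

lemma levy_inversion_finite_measure: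
  assumes fin: "finite_measure M" and M: "sets M = sets borel" and "a \<le> b"
    and atoms: "measure M {a} = 0" "measure M {b} = 0"
  shows "(\<lambda>n. CLBINT z:{- real n..real n}. char M z * interval_kernel a b z)
    \<longlonglongrightarrow> of_real (2 * pi * measure M {a..b})"
proof -
  interpret finite_measure M by fact
  note [measurable_cong] = M
  have sp: "space M = UNIV" using sets_eq_imp_space_eq[OF M] by simp
  define m where "m = measure M (space M)"
  show ?thesis
  proof (cases "m = 0")
    case True
    have "char M z = 0" for z using norm_char_le[of M z] True by (simp add: m_def)
    moreover have "measure M {a..b} = 0"
      using bounded_measure[of "{a..b}"] True by (simp add: m_def measure_le_0_iff)
    ultimately show ?thesis by simp
  next
    case False
    then have m: "0 < m" by (simp add: m_def zero_less_measure_iff)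
    define N where "N = density M (\<lambda>_. ennreal (1 / m))"
    have [simp]: "sets N = sets borel" by (simp add: N_def M)
    have meas: "measure N A = measure M A / m" if "A \<in> sets borel" for A
      using that m unfolding N_def by (subst measure_density_const) (auto simp: M)
    have "emeasure N (space N) = ennreal (1 / m) * emeasure M (space M)"
      unfolding N_def by (simp add: emeasure_density_const)
    also have "emeasure M (space M) = ennreal m"
      unfolding m_def by (rule emeasure_eq_measure)
    also have "ennreal (1 / m) * ennreal m = 1"
      using m by (subst ennreal_mult[symmetric]) auto
    finally have "prob_space N" by (rule prob_spaceI)
    then interpret N: real_distribution N
      by (simp add: real_distribution_def real_distribution_axioms_def)
    have ch: "char N t = char M t / m" for t
      using m unfolding char_def N_def
      by (subst integral_density) (auto simp: scaleR_conv_of_real)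
    have "(\<lambda>n. 1 / (2 * pi) * (CLBINT t=- real n..real n. (iexp (-(t * a)) - iexp (-(t * b))) / (\<i> * t) * char N t))
      \<longlonglongrightarrow> measure N {a<..b}"
      using N.Levy_Inversion[OF \<open>a \<le> b\<close>] atoms by (simp add: meas)
    moreover have "(CLBINT t=- real n..real n. (iexp (-(t * a)) - iexp (-(t * b))) / (\<i> * t) * char N t)
      = (CLBINT z:{- real n..real n}. char M z * interval_kernel a b z) / m" for n
    proof -
      have [measurable]: "char M \<in> borel_measurable borel"
        using continuous_char[OF fin M] by (rule borel_measurable_continuous_onI)
      have "(CLBINT t=- real n..real n. (iexp (-(t * a)) - iexp (-(t * b))) / (\<i> * t) * char N t)
        = (CLBINT t:{- real n..real n}. (iexp (-(t * a)) - iexp (-(t * b))) / (\<i> * t) * char N t)"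
        using interval_integral_Icc[of "- real n" "real n"] by simp
      also have "\<dots> = (CLBINT z:{- real n..real n}. char M z * interval_kernel a b z / m)"
        unfolding set_lebesgue_integral_def[of _ "{- real n..real n}"]
      proof (intro integral_cong_AE)
        show "AE z in lborel. indicat_real {- real n..real n} z *\<^sub>R
          ((iexp (-(z * a)) - iexp (-(z * b))) / (\<i> * z) * char N z) =
          indicat_real {- real n..real n} z *\<^sub>R
          (char M z * interval_kernel a b z / m)"
          using AE_lborel_singleton[of 0]
          by eventually_elim (simp add: interval_kernel_eq[OF \<open>a \<le> b\<close>] ch)
      qed auto
      finally show "(CLBINT t=- real n..real n. (iexp (-(t * a)) - iexp (-(t * b))) / (\<i> * t) * char N t)
        = (CLBINT z:{- real n..real n}. char M z * interval_kernel a b z) / m"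
        by simp
    qed
    ultimately have lim: "(\<lambda>n. 1 / (2 * pi) * ((CLBINT z:{- real n..real n}. char M z *
        interval_kernel a b z) / m)) \<longlonglongrightarrow> of_real (measure N {a<..b})" by (simp only:)
    have "measure M {a..b} = measure M ({a} \<union> {a<..b})"
      using \<open>a \<le> b\<close> by (intro arg_cong[where f="measure M"]) auto
    also have "\<dots> = measure M {a<..b}"
      using atoms by (subst finite_measure_Union) (auto simp: M)
    finally have ab: "measure N {a<..b} = measure M {a..b} / m" by (simp add: meas)
    from tendsto_mult[OF tendsto_const[of "of_real (2 * pi * m)"] lim]
    show ?thesis using m by (simp add: ab mult.assoc)
  qed
qed

lemma char_principal_value:
  assumes fin: "finite_measure M" and M: "sets M = sets borel" and ab: "a \<le> b"
    and atoms: "measure M {a} = 0" "measure M {b} = 0"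
  shows "has_principal_value (\<lambda>z. char M z * interval_kernel a b z)
    (of_real (2 * pi * measure M {a..b}))"
proof -
  let ?m = "measure M (space M)" and ?K = "interval_kernel a b"
  have [measurable]: "char M \<in> borel_measurable borel"
    using continuous_char[OF fin M] by (rule borel_measurable_continuous_onI)
  have int: "set_integrable lborel {-T..T} (\<lambda>z. char M z * ?K z)" for T
    unfolding set_integrable_def
    by (rule integrableI_bounded_set_indicator[where B="?m * (b - a)"])
      (auto simp: norm_mult intro!: mult_mono norm_char_le norm_interval_kernel_le ab AE_I2
        simp: emeasure_lborel_Icc_eq)
  have decay: "norm (char M z * ?K z) \<le> (?m * 2) / \<bar>z\<bar>" if "z \<noteq> 0" for z
    using mult_mono[OF norm_char_le norm_interval_kernel_decay[OF ab that], of M z]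
    by (simp add: norm_mult)
  show ?thesis
    unfolding has_principal_value_def
    using int tendsto_symmetric_integral_real[OF int decay levy_inversion_finite_measure[OF assms]] by auto
qed

section \<open>Densities from integrable characteristic functions\<close>

lemma char_minus: "char M (- t) = cnj (char M t)"
proof -
  have "char M (- t) = (CLINT x|M. cnj (iexp (t * x)))"
    by (simp add: char_def exp_cnj)
  also have "\<dots> = cnj (char M t)"
    unfolding char_def by (rule Bochner_Integration.integral_cnj)
  finally show ?thesis .
qed

text \<open>A continuous function that is negative at a point is bounded away from 0 on an interval next to
  it, where its integral would be negative.\<close>

lemma nonneg_from_interval_integrals:
  fixes g :: "real \<Rightarrow> real"
  assumes g: "continuous_on UNIV g" and int: "\<And>a b. a < b \<Longrightarrow> 0 \<le> (LBINT x:{a..b}. g x)"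
  shows "0 \<le> g x"
proof (rule ccontr)
  assume neg: "\<not> 0 \<le> g x"
  then obtain d where d: "0 < d" "\<And>y. dist y x < d \<Longrightarrow> dist (g y) (g x) < - g x / 2"
    using g[unfolded continuous_on_iff, rule_format, of x "- g x / 2"] by auto
  have "(LBINT y:{x..x + d/2}. g y) \<le> (LBINT y:{x..x + d/2}. g x / 2)"
  proof (rule set_integral_mono)
    show "set_integrable lborel {x..x + d/2} g"
      by (intro borel_integrable_atLeastAtMost' continuous_on_subset[OF g]) auto
    show "set_integrable lborel {x..x + d/2} (\<lambda>_. g x / 2)"
      by (intro borel_integrable_atLeastAtMost' continuous_intros)
    fix y assume "y \<in> {x..x + d/2}"
    then have "dist y x < d" using d(1) by (auto simp: dist_real_def)
    from d(2)[OF this] show "g y \<le> g x / 2" by (auto simp: dist_real_def abs_if split: if_splits)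
  qed
  also have "\<dots> = g x / 2 * (d / 2)" using d(1) by (simp add: set_lebesgue_integral_def)
  also have "\<dots> < 0" using neg d(1) by (intro mult_neg_pos) auto
  finally show False using int[of x "x + d/2"] d(1) by simp
qed

lemma measure_eqI_Icc:
  fixes M N :: "real measure"
  assumes "sets M = sets borel" "sets N = sets borel"
    and eq: "\<And>a b. a \<le> b \<Longrightarrow> emeasure M {a..b} = emeasure N {a..b}"
    and fin: "\<And>a b. emeasure M {a..b} \<noteq> \<infinity>"
  shows "M = N"
proof (rule measure_eqI_generator_eq)
  let ?E = "range (\<lambda>(a, b). {a..b::real})"
  show "Int_stable ?E"
    by (auto simp: Int_stable_def Int_atLeastAtMost)
  show "emeasure M X = emeasure N X" if X: "X \<in> ?E" for X
  proof -
    from X obtain a b where "X = {a..b}" by auto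
    then show ?thesis using eq[of a b] by (cases "a \<le> b") auto
  qed
  have "sets borel = sigma_sets UNIV ?E"
    by (subst borel_eq_atLeastAtMost) simp
  then show "sets M = sigma_sets UNIV ?E" "sets N = sigma_sets UNIV ?E" using assms by auto
  show "(\<Union>n. {- real n..real n}) = UNIV"
  proof safe
    fix x :: real
    obtain n where "\<bar>x\<bar> \<le> real n" using real_arch_simple by blast
    then show "x \<in> (\<Union>n. {- real n..real n})" by (intro UN_I[of n]) auto
  qed auto
qed (use fin in auto)

text \<open>The factor \<open>1 / (2 * pi)\<close> is left out, so that the integral is literally the one in the density
  formulas.\<close>

definition inverse_fourier :: "(real \<Rightarrow> complex) \<Rightarrow> real \<Rightarrow> complex" where
  "inverse_fourier chi x = (CLBINT z. iexp (- (z * x)) * chi z)"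

lemma inverse_fourier_eq: "inverse_fourier chi x = (CLBINT z. iexp ((- x) * z) * chi z)"
  by (simp add: inverse_fourier_def mult.commute)

lemma continuous_inverse_fourier:
  assumes "integrable lborel chi"
  shows "continuous_on UNIV (inverse_fourier chi)"
proof -
  have "continuous_on UNIV ((\<lambda>t. CLBINT z. iexp (t * z) * chi z) \<circ> uminus)"
    by (intro continuous_on_compose continuous_on_subset[OF continuous_fourier_integral] continuous_intros)
      (use assms in auto)
  then show ?thesis by (simp add: comp_def inverse_fourier_eq[abs_def])
qed

lemma norm_inverse_fourier_le: "norm (inverse_fourier chi x) \<le> (LBINT z. norm (chi z))"
  unfolding inverse_fourier_eq by (rule norm_fourier_integral_le)

lemma integral_interval_kernel:
  assumes chi: "integrable lborel chi" and ab: "a \<le> b"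
  shows "(CLBINT z. chi z * interval_kernel a b z) = (CLBINT x:{a..b}. inverse_fourier chi x)"
proof -
  have [measurable]: "chi \<in> borel_measurable borel" using chi by auto
  define G where "G z x = indicator {a..b} x *\<^sub>R (iexp (- (z * x)) * chi z)" for z x :: real
  have [measurable]: "case_prod G \<in> borel_measurable (lborel \<Otimes>\<^sub>M lborel)"
    unfolding G_def by measurable
  have nG: "norm (G z x) = indicator {a..b} x * norm (chi z)" for z x
    by (simp add: G_def norm_mult del: of_real_mult of_real_minus)
  have int: "integrable (lborel \<Otimes>\<^sub>M lborel) (case_prod G)"
  proof (rule lborel_pair.Fubini_integrable)
    show "integrable lborel (\<lambda>z. LBINT x. norm (case (z, x) of (z, x) \<Rightarrow> G z x))"
      using chi by (simp add: nG)
    show "AE z in lborel. integrable lborel (\<lambda>x. case (z, x) of (z, x) \<Rightarrow> G z x)"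
    proof (rule AE_I2)
      fix z
      have "integrable lborel (\<lambda>x. indicator {a..b} x *\<^sub>R (iexp (- (z * x)) * chi z))"
        unfolding set_integrable_def[symmetric]
        by (intro borel_integrable_atLeastAtMost' continuous_intros)
      then show "integrable lborel (\<lambda>x. case (z, x) of (z, x) \<Rightarrow> G z x)" by (simp add: G_def)
    qed
  qed simp
  have "(CLBINT z. chi z * interval_kernel a b z) = (CLBINT z. CLBINT x. G z x)"
  proof (rule Bochner_Integration.integral_cong[OF refl])
    fix z
    have "(CLBINT x. G z x) = (CLBINT x. (indicator {a..b} x *\<^sub>R iexp (- (z * x))) * chi z)"
      by (simp add: G_def)
    also have "\<dots> = (CLBINT x. indicator {a..b} x *\<^sub>R iexp (- (z * x))) * chi z"
      by (rule integral_mult_left_zero)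
    finally show "chi z * interval_kernel a b z = (CLBINT x. G z x)"
      by (simp add: interval_kernel_def set_lebesgue_integral_def mult.commute)
  qed
  also have "\<dots> = (CLBINT x. CLBINT z. G z x)"
    by (rule lborel_pair.Fubini_integral[OF int, symmetric])
  also have "\<dots> = (CLBINT x:{a..b}. inverse_fourier chi x)"
    unfolding set_lebesgue_integral_def G_def inverse_fourier_def
    by (simp only: integral_scaleR_right)
  finally show ?thesis .
qed

text \<open>The kernel of an interval is bounded, so integrability of the characteristic function lets
  dominated convergence evaluate the limit in Levy's theorem as an integral over the whole line.\<close>

lemma measure_interval_eq_integral:
  assumes fin: "finite_measure M" and M: "sets M = sets borel" and ab: "a \<le> b"
    and atoms: "measure M {a} = 0" "measure M {b} = 0"
    and chi: "integrable lborel (char M)"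
  shows "of_real (2 * pi * measure M {a..b}) = (CLBINT x:{a..b}. inverse_fourier (char M) x)"
proof -
  have [measurable]: "char M \<in> borel_measurable borel" using chi by auto
  have "(\<lambda>n. CLBINT z:{- real n..real n}. char M z * interval_kernel a b z)
    \<longlonglongrightarrow> (CLBINT z. char M z * interval_kernel a b z)"
    unfolding set_lebesgue_integral_def
  proof (rule integral_dominated_convergence)
    show "integrable lborel (\<lambda>z. norm (char M z) * (b - a))"
      using chi by (intro integrable_mult_left integrable_norm)
    show "AE z in lborel. (\<lambda>n. indicat_real {- real n..real n} z *\<^sub>R (char M z * interval_kernel a b z))
      \<longlonglongrightarrow> char M z * interval_kernel a b z"
    proof (rule AE_I2, rule tendsto_eventually)
      fix z :: real
      obtain N where N: "\<bar>z\<bar> \<le> real N" using real_arch_simple by blast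
      show "\<forall>\<^sub>F n in sequentially. indicat_real {- real n..real n} z *\<^sub>R
        (char M z * interval_kernel a b z) = char M z * interval_kernel a b z"
        using eventually_ge_at_top[of N]
        by eventually_elim (use N in \<open>auto simp: indicator_def\<close>)
    qed
    show "AE z in lborel. norm (indicat_real {- real n..real n} z *\<^sub>R (char M z * interval_kernel a b z))
      \<le> norm (char M z) * (b - a)" for n
      using norm_interval_kernel_le[OF ab] ab
      by (intro AE_I2) (auto simp: norm_mult indicator_def intro!: mult_left_mono)
  qed auto
  with levy_inversion_finite_measure[OF fin M ab atoms]
  have "of_real (2 * pi * measure M {a..b}) = (CLBINT z. char M z * interval_kernel a b z)"
    by (rule LIMSEQ_unique)
  then show ?thesis using integral_interval_kernel[OF chi ab] by simp
qed

text \<open>Only countably many points carry mass, so every point lies in arbitrarily short intervals with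
  massless endpoints. Their mass is at most their length times the bound on the inverse transform.\<close>

lemma no_atoms_of_integrable_char:
  assumes fin: "finite_measure M" and M: "sets M = sets borel"
    and chi: "integrable lborel (char M)"
  shows "measure M {x} = 0"
proof (rule ccontr)
  interpret finite_measure M by fact
  define C where "C = (LBINT z. norm (char M z))"
  have C: "0 \<le> C" unfolding C_def by (intro Bochner_Integration.integral_nonneg) auto
  assume "measure M {x} \<noteq> 0"
  then have pos: "0 < measure M {x}" by (simp add: zero_less_measure_iff)
  \<comment> \<open>An interval of length less than 2 d around x has mass below that of x.\<close>
  define d where "d = measure M {x} / (C + 1)"
  have d: "0 < d" using pos C by (simp add: d_def)
  from open_minus_countable[OF countable_support, of "{x - d<..<x}"] d
  obtain a where a: "measure M {a} = 0" "x - d < a" "a < x" by auto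
  from open_minus_countable[OF countable_support, of "{x<..<x + d}"] d
  obtain b where b: "measure M {b} = 0" "x < b" "b < x + d" by auto
  have ab: "a \<le> b" using a b by simp
  have "2 * pi * measure M {a..b} = norm (complex_of_real (2 * pi * measure M {a..b}))"
    by (simp add: norm_mult)
  also have "\<dots> = norm (CLBINT x:{a..b}. inverse_fourier (char M) x)"
    by (simp only: measure_interval_eq_integral[OF fin M ab a(1) b(1) chi])
  also have "\<dots> \<le> (LBINT x:{a..b}. norm (inverse_fourier (char M) x))"
    by (intro set_integral_norm_bound borel_integrable_atLeastAtMost'
        continuous_on_subset[OF continuous_inverse_fourier[OF chi]]) auto
  also have "\<dots> \<le> (LBINT x:{a..b}. C)"
    using norm_inverse_fourier_le[of "char M"] unfolding C_def
    by (intro set_integral_mono borel_integrable_atLeastAtMost' continuous_intros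
        continuous_on_subset[OF continuous_inverse_fourier[OF chi]]) auto
  also have "\<dots> = C * (b - a)" using ab by (simp add: set_lebesgue_integral_def)
  also have "\<dots> \<le> C * (2 * d)" using a b C by (intro mult_left_mono) auto
  also have "\<dots> < (C + 1) * (2 * d)" using d by simp
  also have "\<dots> = 2 * measure M {x}" using C by (simp add: d_def)
  finally have "pi * measure M {a..b} < measure M {x}" by simp
  moreover have "measure M {x} \<le> measure M {a..b}"
    using a b by (intro finite_measure_mono) (auto simp: M)
  moreover have "1 * measure M {a..b} \<le> pi * measure M {a..b}"
    using pi_ge_two by (intro mult_right_mono) auto
  ultimately show False by simp
qed

text \<open>The inverse transform is real because \<open>char M (- z)\<close> is the conjugate of \<open>char M z\<close>, and
  nonnegative because its integrals over intervals are masses.\<close>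

lemma density_of_integrable_char:
  assumes fin: "finite_measure M" and M: "sets M = sets borel"
    and chi: "integrable lborel (char M)"
  defines "f \<equiv> \<lambda>x. Re (inverse_fourier (char M) x) / (2 * pi)"
  shows "of_real (f x) = of_real (1 / (2 * pi)) * inverse_fourier (char M) x"
    and "0 \<le> f x" and "continuous_on UNIV f" and "bounded (range f)"
    and "M = density lborel f"
proof -
  interpret finite_measure M by fact
  let ?F = "inverse_fourier (char M)"
  note contF = continuous_inverse_fourier[OF chi]
  show contf: "continuous_on UNIV f"
    unfolding f_def by (intro continuous_intros contF) auto
  have "norm (f x) \<le> (LBINT z. norm (char M z)) / (2 * pi)" for x
    using order_trans[OF abs_Re_le_cmod norm_inverse_fourier_le[of "char M" x]]
    by (simp add: f_def divide_right_mono)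
  then show "bounded (range f)" by (auto simp: bounded_iff)
  have real: "?F x = of_real (Re (?F x))" for x
  proof -
    \<comment> \<open>Substitute -z for z.\<close>
    have "?F x = (CLBINT z. iexp (- (- z * x)) * char M (- z))"
      unfolding inverse_fourier_def
      by (subst lborel_integral_real_affine[where c="-1" and t=0]) auto
    also have "\<dots> = cnj (?F x)"
    proof -
      have "(CLBINT z. iexp (- (- z * x)) * char M (- z)) = (CLBINT z. cnj (iexp (- (z * x)) * char M z))"
        by (simp add: char_minus exp_cnj)
      then show ?thesis
        unfolding inverse_fourier_def by (simp only: Bochner_Integration.integral_cnj)
    qed
    finally show ?thesis by (metis Reals_cnj_iff of_real_Re)
  qed
  then show "of_real (f x) = of_real (1 / (2 * pi)) * ?F x"
    by (metis (no_types, lifting) f_def mult.left_neutral of_real_mult times_divide_eq_left)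
  have meas: "measure M {a..b} = (LBINT x:{a..b}. f x)" if "a \<le> b" for a b
  proof -
    have "of_real (2 * pi * measure M {a..b}) = (CLBINT x:{a..b}. ?F x)"
      by (rule measure_interval_eq_integral[OF fin M that _ _ chi])
        (rule no_atoms_of_integrable_char[OF fin M chi])+
    also have "\<dots> = (CLBINT x:{a..b}. of_real (2 * pi * f x))"
      using real by (intro set_lebesgue_integral_cong) (auto simp: f_def)
    also have "\<dots> = of_real (LBINT x:{a..b}. 2 * pi * f x)"
      by (rule set_integral_complex_of_real)
    finally show ?thesis by simp
  qed
  show nonneg: "0 \<le> f x" for x
    using contf by (rule nonneg_from_interval_integrals) (simp flip: meas)
  have [measurable]: "f \<in> borel_measurable borel"
    using contf by (rule borel_measurable_continuous_onI)
  show "M = density lborel f"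
  proof (rule measure_eqI_Icc)
    fix a b :: real assume ab: "a \<le> b"
    have "emeasure (density lborel f) {a..b} = (\<integral>\<^sup>+x. ennreal (indicator {a..b} x *\<^sub>R f x) \<partial>lborel)"
      by (subst emeasure_density) (auto intro!: nn_integral_cong simp: indicator_def)
    also have "\<dots> = ennreal (LBINT x:{a..b}. f x)"
      unfolding set_lebesgue_integral_def
    proof (rule nn_integral_eq_integral)
      show "integrable lborel (\<lambda>x. indicat_real {a..b} x *\<^sub>R f x)"
        using borel_integrable_atLeastAtMost'[of a b f] continuous_on_subset[OF contf]
        by (auto simp: set_integrable_def)
    qed (use nonneg in auto)
    finally show "emeasure M {a..b} = emeasure (density lborel f) {a..b}"
      using ab by (simp add: emeasure_eq_measure meas)
  qed (auto simp: M)
qed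

text \<open>The weight turns \<open>U\<close>, which may be infinite near 0, into a finite measure with density \<open>f\<close>;
  then \<open>U\<close> has density \<open>f / w\<close>. The weight may vanish at 0, which is why bounds are claimed only
  off neighbourhoods of 0.\<close>

lemma levy_density_of_integrable_char:
  fixes w :: "real \<Rightarrow> real"
  assumes U: "sets U = sets borel" "emeasure U {0} = 0"
    and w [measurable]: "w \<in> borel_measurable borel"
    and w_nonneg: "\<And>x. 0 \<le> w x"
    and w_cont: "continuous_on (- {0}) w"
    and w_lower: "\<And>\<epsilon>. 0 < \<epsilon> \<Longrightarrow> \<exists>c>0. \<forall>x. \<epsilon> \<le> \<bar>x\<bar> \<longrightarrow> c \<le> w x"
    and fin: "finite_measure (density U w)"
    and chi: "integrable lborel (char (density U w))"
  shows "absolutely_continuous lborel U \<and>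
    (\<exists>u. lebesgue_density U u \<and> bounded_continuous_off_zero u \<and>
      (\<forall>x. x \<noteq> 0 \<longrightarrow> complex_of_real (u x) =
        of_real (1 / (2 * pi * w x)) * inverse_fourier (char (density U w)) x))"
proof -
  let ?M = "density U w"
  note [measurable_cong] = U(1)
  have M: "sets ?M = sets borel" using U by simp
  define f where "f = (\<lambda>x. Re (inverse_fourier (char ?M) x) / (2 * pi))"
  have f: "of_real (f x) = of_real (1 / (2 * pi)) * inverse_fourier (char ?M) x"
    "0 \<le> f x" "continuous_on UNIV f" "bounded (range f)" "?M = density lborel f" for x
    unfolding f_def by (rule density_of_integrable_char[OF fin M chi])+
  have [measurable]: "f \<in> borel_measurable borel"
    using f(3) by (rule borel_measurable_continuous_onI)
  define u where "u x = f x / w x" for x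
  have [measurable]: "u \<in> borel_measurable borel" unfolding u_def by measurable
  have w_pos: "0 < w x" if "x \<noteq> 0" for x
    using w_lower[of "\<bar>x\<bar>"] that by force
  have "AE x in U. x \<noteq> 0"
    using U by (intro AE_I[of _ _ "{0}"]) auto
  then have "density U (\<lambda>_. 1) = density U (\<lambda>x. ennreal (w x) * ennreal (1 / w x))"
    by (intro density_cong)
      (auto elim!: eventually_mono dest!: w_pos simp: ennreal_mult[symmetric])
  then have "U = density U (\<lambda>x. ennreal (w x) * ennreal (1 / w x))" by (simp add: density_1)
  also have "\<dots> = density ?M (\<lambda>x. ennreal (1 / w x))"
    by (subst density_density_eq) auto
  also have "\<dots> = density (density lborel f) (\<lambda>x. ennreal (1 / w x))" using f(5) by simp
  also have "\<dots> = density lborel (\<lambda>x. ennreal (f x) * ennreal (1 / w x))"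
    by (subst density_density_eq) auto
  also have "(\<lambda>x. ennreal (f x) * ennreal (1 / w x)) = (\<lambda>x. ennreal (u x))"
    using f(2) w_nonneg by (simp add: u_def ennreal_mult[symmetric])
  finally have dens: "U = density lborel (\<lambda>x. ennreal (u x))" .
  have "bounded_continuous_off_zero u"
    unfolding bounded_continuous_off_zero_def
  proof (intro conjI allI impI)
    show "continuous_on (- {0}) u"
      unfolding u_def
      by (intro continuous_intros w_cont continuous_on_subset[OF f(3)]) (auto dest: w_pos)
    fix \<epsilon> :: real assume "0 < \<epsilon>"
    from w_lower[OF this] obtain c where c: "0 < c" "\<And>x. \<epsilon> \<le> \<bar>x\<bar> \<Longrightarrow> c \<le> w x" by auto
    from f(4) obtain B where B: "\<And>x. \<bar>f x\<bar> \<le> B" by (auto simp: bounded_iff)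
    have "norm (u x) \<le> B / c" if "\<epsilon> \<le> \<bar>x\<bar>" for x
      using c(2)[OF that] c(1) B[of x]
      by (auto simp: u_def abs_divide intro!: frac_le)
    then show "bounded (u ` {x. \<epsilon> \<le> \<bar>x\<bar>})" by (auto simp: bounded_iff)
  qed
  moreover have "lebesgue_density U u"
    unfolding lebesgue_density_def using dens f(2) w_nonneg by (auto simp: u_def)
  moreover have "absolutely_continuous lborel U"
    by (subst dens, rule absolutely_continuousI_density) auto
  moreover have "complex_of_real (u x) = of_real (1 / (2 * pi * w x)) * inverse_fourier (char ?M) x" for x
    by (simp add: u_def f(1))
  ultimately show ?thesis by blast
qed

section \<open>The cumulant function\<close>

text \<open>The sets \<open>1 / n \<le> \<bar>x\<bar>\<close> have finite mass because \<open>min 1 (x\<^sup>2)\<close> is bounded below on them, and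
  they exhaust the line up to the null point 0. Fubini's theorem for \<open>U\<close> rests on this.\<close>

lemma sigma_finite_levy_measure:
  assumes "levy_measure U"
  shows "sigma_finite_measure U"
proof
  have U: "sets U = sets borel" "emeasure U {0} = 0" "(\<integral>\<^sup>+x. ennreal (min 1 (x\<^sup>2)) \<partial>U) < \<infinity>"
    using assms by (auto simp: levy_measure_def)
  note [measurable_cong] = U(1)
  define A where "A n = {x::real. 1 / real (Suc n) \<le> \<bar>x\<bar>}" for n
  have [measurable]: "A n \<in> sets borel" for n unfolding A_def by measurable
  have fin: "emeasure U (A n) \<noteq> \<infinity>" for n
  proof -
    have "emeasure U (A n) = (\<integral>\<^sup>+x. indicator (A n) x \<partial>U)" by simp
    also have "\<dots> \<le> (\<integral>\<^sup>+x. ennreal ((real (Suc n))\<^sup>2) * ennreal (min 1 (x\<^sup>2)) \<partial>U)"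
    proof (rule nn_integral_mono)
      fix x :: real
      show "indicator (A n) x \<le> ennreal ((real (Suc n))\<^sup>2) * ennreal (min 1 (x\<^sup>2))"
      proof (cases "x \<in> A n")
        case True
        have "1 \<le> \<bar>x\<bar> * real (Suc n)" using True by (simp add: A_def field_simps)
        then have "1 \<le> (\<bar>x\<bar> * real (Suc n))\<^sup>2" by (rule one_le_power)
        then have "1 \<le> (real (Suc n))\<^sup>2 * x\<^sup>2" by (simp add: power_mult_distrib mult.commute)
        moreover have "1 \<le> (real (Suc n))\<^sup>2" by (rule one_le_power) simp
        ultimately have "1 \<le> (real (Suc n))\<^sup>2 * min 1 (x\<^sup>2)" by (simp add: min_def)
        then have "ennreal 1 \<le> ennreal ((real (Suc n))\<^sup>2 * min 1 (x\<^sup>2))" by (rule ennreal_leI)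
        then show ?thesis using True by (simp add: ennreal_mult del: of_nat_Suc)
      qed simp
    qed
    also have "\<dots> = ennreal ((real (Suc n))\<^sup>2) * (\<integral>\<^sup>+x. ennreal (min 1 (x\<^sup>2)) \<partial>U)"
      by (rule nn_integral_cmult) simp
    also have "\<dots> < \<infinity>" using U(3) by (simp add: ennreal_mult_less_top del: of_nat_Suc)
    finally show ?thesis by simp
  qed
  show "\<exists>S. countable S \<and> S \<subseteq> sets U \<and> \<Union>S = space U \<and> (\<forall>a\<in>S. emeasure U a \<noteq> \<infinity>)"
  proof (intro exI[of _ "insert {0} (range A)"] conjI)
    have "x \<in> \<Union> (insert {0} (range A))" for x :: real
    proof (cases "x = 0")
      case False
      then obtain n where "inverse (real (Suc n)) < \<bar>x\<bar>"
        using reals_Archimedean[of "\<bar>x\<bar>"] by auto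
      then have "x \<in> A n" by (simp add: A_def field_simps del: of_nat_Suc)
      then show ?thesis by auto
    qed auto
    then show "\<Union> (insert {0} (range A)) = space U"
      using sets_eq_imp_space_eq[OF U(1)] by auto
  qed (use U fin in auto)
qed

lemma integrable_levy_bounded:
  fixes f :: "real \<Rightarrow> 'b::{banach, second_countable_topology}"
  assumes U: "levy_measure U" and f: "f \<in> borel_measurable borel"
    and bound: "\<And>x. norm (f x) \<le> C * min 1 (x\<^sup>2)"
  shows "integrable U f"
proof -
  have s: "sets U = sets borel" using U by (simp add: levy_measure_def)
  note [measurable_cong] = s
  have "integrable U (\<lambda>x. min 1 (x\<^sup>2))"
    using U by (intro integrableI_nonneg) (auto simp: levy_measure_def)
  then have "integrable U (\<lambda>x. C * min 1 (x\<^sup>2))" by (rule integrable_mult_right)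
  then show ?thesis
  proof (rule Bochner_Integration.integrable_bound)
    show "f \<in> borel_measurable U" using f by measurable
    show "AE x in U. norm (f x) \<le> norm (C * min 1 (x\<^sup>2))"
      using bound by (intro AE_I2) (metis abs_ge_self order_trans real_norm_def)
  qed
qed

text \<open>Both defining asymptotics become global estimates, because \<open>h\<close> is bounded: away from 0
  a constant is at most a multiple of \<open>\<bar>x\<bar>\<close>, and on a bounded set \<open>x h x\<close> is bounded.\<close>

lemma truncation_function_bounds:
  assumes h: "truncation_function h"
  obtains C where "0 \<le> C" "\<And>x. \<bar>x * h x\<bar> \<le> C" "\<And>x. \<bar>x - x * h x\<bar> \<le> C * x\<^sup>2"
proof -
  obtain H where H: "\<And>x. \<bar>h x\<bar> \<le> H"
    using h by (auto simp: truncation_function_def bounded_iff)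
  then have H0: "0 \<le> H" by (meson abs_ge_zero order_trans)
  have "\<forall>\<^sub>F x in at 0. norm (h x - 1) \<le> 1 * norm x"
    using h by (intro landau_o.smallD) (auto simp: truncation_function_def)
  then obtain d where d: "0 < d" "\<And>x. x \<noteq> 0 \<Longrightarrow> \<bar>x\<bar> < d \<Longrightarrow> \<bar>h x - 1\<bar> \<le> \<bar>x\<bar>"
    by (auto simp: eventually_at)
  obtain c where c: "0 < c" "\<forall>\<^sub>F x in at_infinity. norm (h x) \<le> c * norm (1 / x)"
    using h by (auto simp: truncation_function_def elim!: landau_o.bigE)
  then obtain R where R: "\<And>x. R \<le> \<bar>x\<bar> \<Longrightarrow> \<bar>h x\<bar> \<le> c * \<bar>1 / x\<bar>"
    by (auto simp: eventually_at_infinity)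
  define C where "C = c + \<bar>R\<bar> * H + 1 + (1 + H) / d"
  show thesis
  proof
    show "0 \<le> C" using c H0 d by (auto simp: C_def)
    fix x
    have "\<bar>x * h x\<bar> \<le> c + \<bar>R\<bar> * H"
    proof (cases "R \<le> \<bar>x\<bar>")
      case True
      have "\<bar>x * h x\<bar> \<le> \<bar>x\<bar> * (c * \<bar>1 / x\<bar>)"
        unfolding abs_mult using R[OF True] by (intro mult_left_mono) auto
      also have "\<dots> \<le> c" using c(1) by (cases "x = 0") auto
      finally show ?thesis using H0 by (meson abs_ge_zero add_increasing2 mult_nonneg_nonneg)
    next
      case False
      then have "\<bar>x * h x\<bar> \<le> \<bar>R\<bar> * H"
        unfolding abs_mult using H[of x] by (intro mult_mono) auto
      then show ?thesis using c(1) by simp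
    qed
    moreover have "0 \<le> 1 + (1 + H) / d" using H0 d by simp
    ultimately show "\<bar>x * h x\<bar> \<le> C" by (simp add: C_def)
    have "\<bar>x - x * h x\<bar> \<le> (1 + (1 + H) / d) * x\<^sup>2"
    proof -
      have eq: "\<bar>x - x * h x\<bar> = \<bar>x\<bar> * \<bar>h x - 1\<bar>"
        by (simp add: abs_mult[symmetric] algebra_simps abs_minus_commute)
      have "\<bar>h x - 1\<bar> \<le> (1 + (1 + H) / d) * \<bar>x\<bar>" if "x \<noteq> 0"
      proof (cases "\<bar>x\<bar> < d")
        case True
        have "0 \<le> (1 + H) / d * \<bar>x\<bar>" using H0 d by simp
        with d(2)[OF that True] show ?thesis by (simp add: distrib_right)
      next
        case False
        have "\<bar>h x - 1\<bar> \<le> 1 + H" using H[of x] by linarith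
        also have "\<dots> = (1 + H) / d * d" using d by simp
        also have "\<dots> \<le> (1 + H) / d * \<bar>x\<bar>" using False H0 d by (intro mult_left_mono) auto
        finally show ?thesis by (simp add: distrib_right)
      qed
      then have "\<bar>x\<bar> * \<bar>h x - 1\<bar> \<le> \<bar>x\<bar> * ((1 + (1 + H) / d) * \<bar>x\<bar>)"
        by (cases "x = 0") (auto intro: mult_left_mono)
      then show ?thesis unfolding eq by (simp add: power2_eq_square mult.assoc mult.left_commute)
    qed
    moreover have "0 \<le> (c + \<bar>R\<bar> * H) * x\<^sup>2" using c H0 by simp
    ultimately show "\<bar>x - x * h x\<bar> \<le> C * x\<^sup>2" by (simp add: C_def algebra_simps)
  qed
qed

definition levy_integrand :: "(real \<Rightarrow> real) \<Rightarrow> real \<Rightarrow> real \<Rightarrow> complex" where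
  "levy_integrand h z x = iexp (z * x) - 1 - \<i> * of_real (z * x * h x)"

text \<open>Near 0 split off the Taylor remainder \<open>exp (i z x) - 1 - i z x\<close>; it and the rest
  \<open>i z (x - x h x)\<close> are both of order \<open>x\<^sup>2\<close>; elsewhere each term is bounded.\<close>

lemma levy_integrand_bound:
  assumes C: "0 \<le> C" "\<And>x. \<bar>x * h x\<bar> \<le> C" "\<And>x. \<bar>x - x * h x\<bar> \<le> C * x\<^sup>2"
  shows "norm (levy_integrand h z x) \<le> (2 + z\<^sup>2 + C * \<bar>z\<bar>) * min 1 (x\<^sup>2)"
proof -
  have "norm (levy_integrand h z x) \<le> norm (iexp (z * x) - 1) + norm (\<i> * of_real (z * x * h x))"
    unfolding levy_integrand_def by (rule norm_triangle_ineq4)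
  also have "norm (iexp (z * x) - 1) \<le> 1 + 1"
    by (rule order_trans[OF norm_triangle_ineq4]) simp
  also have "norm (\<i> * of_real (z * x * h x)) = \<bar>z\<bar> * \<bar>x * h x\<bar>"
    by (simp add: norm_mult abs_mult mult.assoc)
  also have "\<dots> \<le> \<bar>z\<bar> * C" using C(2) by (intro mult_left_mono) auto
  finally have 1: "norm (levy_integrand h z x) \<le> (2 + z\<^sup>2 + C * \<bar>z\<bar>) * 1"
    using zero_le_power2[of z] by (simp only: mult.commute[of C] mult_1_right) linarith
  have "levy_integrand h z x = (iexp (z * x) - (1 + \<i> * of_real (z * x))) + \<i> * of_real (z * (x - x * h x))"
    by (simp add: levy_integrand_def algebra_simps)
  then have "norm (levy_integrand h z x) \<le> norm (iexp (z * x) - (1 + \<i> * of_real (z * x)))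
      + norm (\<i> * of_real (z * (x - x * h x)))"
    by (metis norm_triangle_ineq)
  also have "norm (iexp (z * x) - (1 + \<i> * of_real (z * x))) \<le> \<bar>z * x\<bar>^2 / 2"
    using iexp_approx1[of "z * x" 1] by (simp add: numeral_2_eq_2)
  also have "norm (\<i> * of_real (z * (x - x * h x))) = \<bar>z\<bar> * \<bar>x - x * h x\<bar>"
    by (simp only: norm_mult norm_ii norm_of_real abs_mult mult_1)
  also have "\<dots> \<le> \<bar>z\<bar> * (C * x\<^sup>2)" using C(3) by (intro mult_left_mono) auto
  also have "\<bar>z * x\<bar>^2 / 2 + \<bar>z\<bar> * (C * x\<^sup>2) \<le> (2 + z\<^sup>2 + C * \<bar>z\<bar>) * x\<^sup>2"
    by (simp add: power_mult_distrib algebra_simps)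
  finally have 2: "norm (levy_integrand h z x) \<le> (2 + z\<^sup>2 + C * \<bar>z\<bar>) * x\<^sup>2" by simp
  show ?thesis using 1 2 by (simp add: min_def)
qed

lemma measurable_levy_integrand [measurable (raw)]:
  assumes "h \<in> borel_measurable borel" "f \<in> borel_measurable M" "g \<in> borel_measurable M"
  shows "(\<lambda>p. levy_integrand h (f p) (g p)) \<in> borel_measurable M"
proof -
  note [measurable] = assms
  show ?thesis unfolding levy_integrand_def by measurable
qed

lemma integrable_levy_integrand:
  assumes U: "levy_measure U" and h: "truncation_function h"
  shows "integrable U (levy_integrand h z)"
proof -
  have [measurable]: "h \<in> borel_measurable borel" using h by (simp add: truncation_function_def)
  from h obtain C where "0 \<le> C" "\<And>x. \<bar>x * h x\<bar> \<le> C" "\<And>x. \<bar>x - x * h x\<bar> \<le> C * x\<^sup>2"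
    by (rule truncation_function_bounds) blast
  from levy_integrand_bound[OF this] show ?thesis
    by (intro integrable_levy_bounded[OF U]) auto
qed

lemma cumulant_eq_levy_integrand:
  "cumulant \<gamma> \<sigma> h U z = \<i> * of_real (\<gamma> * z) - of_real (\<sigma>\<^sup>2 * z\<^sup>2 / 2) + (LINT x|U. levy_integrand h z x)"
  by (simp add: cumulant_def levy_integrand_def)

section \<open>The averaged increment\<close>

text \<open>The weight is twice the one in the theorem, so that the increment integrated over \<open>[-1, 1]\<close> is exactly
  a characteristic function. Division by zero gives the value 0 at the origin.\<close>

definition sinc_weight :: "real \<Rightarrow> real" where
  "sinc_weight x = 2 * ((x - sin x) / x)"

lemma integral_iexp_symmetric:
  "(CLBINT l:{-1..1}. iexp (l * x)) = of_real (2 - sinc_weight x)"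
proof (cases "x = 0")
  case True
  then show ?thesis
    by (simp add: sinc_weight_def set_lebesgue_integral_def scaleR_conv_of_real)
next
  case False
  have "(CLBINT l:{-1..1}. iexp (l * x)) = interval_kernel (-1) 1 (- x)"
    by (simp add: interval_kernel_def mult.commute)
  also have "\<dots> = (iexp x - iexp (- x)) / (\<i> * x)"
    using False by (subst interval_kernel_eq) (auto simp: divide_simps)
  also have "\<dots> = of_real (2 * sin x / x)"
    using False by (simp add: complex_eq_iff Re_exp Im_exp Re_divide Im_divide power2_eq_square field_simps)
  also have "2 * sin x / x = 2 - sinc_weight x"
    using False by (simp add: sinc_weight_def field_simps)
  finally show ?thesis .
qed

text \<open>The compensator contributes a term odd in \<open>l\<close>, so its integral vanishes, whatever \<open>h\<close> is.\<close>

lemma integral_levy_integrand_increment: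
  "(CLBINT l:{-1..1}. levy_integrand h z x - levy_integrand h (z + l) x) = of_real (sinc_weight x) * iexp (z * x)"
proof -
  have eq: "levy_integrand h z x - levy_integrand h (z + l) x
    = (iexp (z * x) - iexp (z * x) * iexp (l * x)) + of_real l * (\<i> * of_real (x * h x))" for l
    by (simp add: levy_integrand_def algebra_simps exp_add)
  have i: "set_integrable lborel {-1..1} (\<lambda>l::real. iexp (z * x))"
    "set_integrable lborel {-1..1} (\<lambda>l. iexp (z * x) * iexp (l * x))"
    "set_integrable lborel {-1..1} (\<lambda>l. complex_of_real l * (\<i> * of_real (x * h x)))"
    by (rule borel_integrable_atLeastAtMost', intro continuous_intros)+
  have "(LBINT l:{-1..1}. l) = (0::real)"
    using integral_power[of "-1" 1 1] by (simp add: set_lebesgue_integral_def mult.commute)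
  then have odd: "(CLBINT l:{-1..1}. complex_of_real l) = 0"
    by (simp add: set_integral_complex_of_real)
  have "(CLBINT l:{-1..1}. levy_integrand h z x - levy_integrand h (z + l) x)
    = ((CLBINT l:{-1..1::real}. iexp (z * x)) - (CLBINT l:{-1..1}. iexp (z * x) * iexp (l * x)))
      + (CLBINT l:{-1..1}. of_real l * (\<i> * of_real (x * h x)))"
    unfolding eq using i by (simp add: set_integral_add set_integral_diff del: of_real_mult)
  also have "(CLBINT l:{-1..1::real}. iexp (z * x)) = 2 * iexp (z * x)"
    by (simp add: set_lebesgue_integral_def scaleR_conv_of_real)
  also have "(CLBINT l:{-1..1}. iexp (z * x) * iexp (l * x)) = iexp (z * x) * of_real (2 - sinc_weight x)"
    by (subst integral_iexp_symmetric[symmetric]) (rule set_integral_mult_right)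
  also have "(CLBINT l:{-1..1}. of_real l * (\<i> * of_real (x * h x))) = 0"
    by (subst set_integral_mult_left) (simp add: odd)
  finally show ?thesis by (simp add: algebra_simps)
qed

text \<open>The part of the increment outside the Levy integral is a quadratic polynomial in \<open>l\<close>; its even
  part integrates to \<open>\<sigma>\<^sup>2 / 3\<close>. The rest is Fubini, with majorant a multiple of \<open>min 1 (x\<^sup>2)\<close>.\<close>

lemma rho_hat_cumulant:
  assumes U: "levy_measure U" and h: "truncation_function h"
  shows "rho_hat (cumulant \<gamma> \<sigma> h U) \<sigma> z = (CLINT x|U. of_real (sinc_weight x) * iexp (z * x))"
proof -
  have s: "sets U = sets borel" using U by (simp add: levy_measure_def)
  note [measurable_cong] = s
  have [measurable]: "h \<in> borel_measurable borel" using h by (simp add: truncation_function_def)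
  interpret U: sigma_finite_measure U by (rule sigma_finite_levy_measure[OF U])
  interpret P: pair_sigma_finite lborel U ..
  from h obtain C where C: "0 \<le> C" "\<And>x. \<bar>x * h x\<bar> \<le> C" "\<And>x. \<bar>x - x * h x\<bar> \<le> C * x\<^sup>2"
    by (rule truncation_function_bounds) blast
  define D where "D l x = levy_integrand h z x - levy_integrand h (z + l) x" for l x
  define K where "K = 2 * (2 + (\<bar>z\<bar> + 1)\<^sup>2 + C * (\<bar>z\<bar> + 1))"
  have bound1: "norm (levy_integrand h y x) \<le> K / 2 * min 1 (x\<^sup>2)" if "\<bar>y\<bar> \<le> \<bar>z\<bar> + 1" for y x
  proof (rule order_trans[OF levy_integrand_bound[OF C]], rule mult_right_mono)
    have "y\<^sup>2 \<le> (\<bar>z\<bar> + 1)\<^sup>2" using power_mono[OF that, of 2] by simp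
    moreover have "C * \<bar>y\<bar> \<le> C * (\<bar>z\<bar> + 1)" using that C(1) by (rule mult_left_mono)
    ultimately show "2 + y\<^sup>2 + C * \<bar>y\<bar> \<le> K / 2" by (simp add: K_def)
  qed simp
  have bound: "norm (D l x) \<le> K * min 1 (x\<^sup>2)" if "l \<in> {-1..1}" for l x
  proof -
    have "norm (D l x) \<le> norm (levy_integrand h z x) + norm (levy_integrand h (z + l) x)"
      unfolding D_def by (rule norm_triangle_ineq4)
    also have "\<dots> \<le> K / 2 * min 1 (x\<^sup>2) + K / 2 * min 1 (x\<^sup>2)"
      using that by (intro add_mono bound1) auto
    finally show ?thesis by (simp add: field_simps)
  qed
  have [measurable]: "case_prod D \<in> borel_measurable (lborel \<Otimes>\<^sub>M U)"
    unfolding D_def by measurable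
  define G where "G l x = indicat_real {-1..1} l *\<^sub>R D l x" for l x
  have [measurable]: "case_prod G \<in> borel_measurable (lborel \<Otimes>\<^sub>M U)"
    unfolding G_def by measurable
  have int_min: "integrable U (\<lambda>x. min 1 (x\<^sup>2))"
    by (rule integrable_levy_bounded[OF U, of _ 1]) auto
  have "integrable (lborel \<Otimes>\<^sub>M U) (\<lambda>(l::real, x). indicat_real {-1..1} l * (K * min 1 (x\<^sup>2)))"
  proof (rule P.Fubini_integrable)
    have "integrable lborel (indicat_real {-1..1::real})"
      by (simp add: integrable_indicator_iff)
    then show "integrable lborel (\<lambda>l::real. LINT x|U. norm (case (l, x) of (l, x) \<Rightarrow>
        indicat_real {-1..1} l * (K * min 1 (x\<^sup>2))))"
      by (simp add: abs_mult)
    show "AE l::real in lborel. integrable U (\<lambda>x. case (l, x) of (l, x) \<Rightarrow>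
        indicat_real {-1..1} l * (K * min 1 (x\<^sup>2)))"
      using int_min by (intro AE_I2) simp
  qed measurable
  then have int: "integrable (lborel \<Otimes>\<^sub>M U) (case_prod G)"
  proof (rule Bochner_Integration.integrable_bound)
    show "AE p in lborel \<Otimes>\<^sub>M U. norm (case_prod G p) \<le>
      norm (case p of (l::real, x) \<Rightarrow> indicat_real {-1..1} l * (K * min 1 (x\<^sup>2)))"
      using bound order_trans[OF bound abs_ge_self] by (intro AE_I2) (auto simp: G_def indicator_def split: prod.split)
  qed simp
  have increment: "cumulant \<gamma> \<sigma> h U z - cumulant \<gamma> \<sigma> h U (z + l)
    = (of_real (\<sigma>\<^sup>2 / 2) * of_real (l\<^sup>2) + of_real l * (of_real (\<sigma>\<^sup>2 * z) - \<i> * of_real \<gamma>)) + (CLINT x|U. D l x)" for l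
  proof -
    have "(CLINT x|U. D l x) = (CLINT x|U. levy_integrand h z x) - (CLINT x|U. levy_integrand h (z + l) x)"
      unfolding D_def by (intro Bochner_Integration.integral_diff integrable_levy_integrand U h)
    then have "(CLINT x|U. levy_integrand h z x)
        = (CLINT x|U. D l x) + (CLINT x|U. levy_integrand h (z + l) x)"
      by simp
    then show ?thesis
      by (simp add: cumulant_eq_levy_integrand power2_eq_square field_simps)
  qed
  have DU: "set_integrable lborel {-1..1} (\<lambda>l. CLINT x|U. D l x)"
    using P.integrable_fst[OF int] by (simp add: set_integrable_def G_def)
  have "(LBINT l:{-1..1}. l) = (0::real)" "(LBINT l:{-1..1}. l\<^sup>2) = (2/3::real)"
    using integral_power[of "-1" 1 1] integral_power[of "-1" 1 2]
    by (simp_all add: set_lebesgue_integral_def mult.commute)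
  then have pows: "(CLBINT l:{-1..1}. complex_of_real l) = 0" "(CLBINT l:{-1..1}. complex_of_real (l\<^sup>2)) = of_real (2/3)"
    by (simp_all only: set_integral_complex_of_real of_real_0)
  have i: "set_integrable lborel {-1..1} (\<lambda>l. complex_of_real (\<sigma>\<^sup>2 / 2) * of_real (l\<^sup>2))"
    "set_integrable lborel {-1..1} (\<lambda>l. complex_of_real l * (of_real (\<sigma>\<^sup>2 * z) - \<i> * of_real \<gamma>))"
    by (rule borel_integrable_atLeastAtMost', intro continuous_intros)+
  have "(CLBINT l:{-1..1}. cumulant \<gamma> \<sigma> h U z - cumulant \<gamma> \<sigma> h U (z + l))
    = ((CLBINT l:{-1..1}. of_real (\<sigma>\<^sup>2 / 2) * of_real (l\<^sup>2))
      + (CLBINT l:{-1..1}. of_real l * (of_real (\<sigma>\<^sup>2 * z) - \<i> * of_real \<gamma>)))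
      + (CLBINT l:{-1..1}. (CLINT x|U. D l x))"
    unfolding increment using i DU by (simp only: set_integral_add)
  also have "\<dots> = of_real (\<sigma>\<^sup>2 / 3) + (CLBINT l:{-1..1}. (CLINT x|U. D l x))"
    by (simp only: set_integral_mult_right set_integral_mult_left pows) simp
  also have "(CLBINT l:{-1..1}. (CLINT x|U. D l x)) = (CLBINT l. (CLINT x|U. G l x))"
    by (simp add: set_lebesgue_integral_def G_def)
  also have "\<dots> = (CLINT x|U. (CLBINT l. G l x))"
    by (rule P.Fubini_integral[OF int, symmetric])
  also have "\<dots> = (CLINT x|U. of_real (sinc_weight x) * iexp (z * x))"
    unfolding integral_levy_integrand_increment[of h z, symmetric]
    by (simp add: G_def D_def set_lebesgue_integral_def)
  finally show ?thesis by (simp add: rho_hat_def)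
qed

section \<open>The second derivative of the cumulant function\<close>

text \<open>The first-order remainder, not the derivative, is what has to be dominated. For the Levy integrand
  it is \<open>O(x\<^sup>2)\<close> uniformly in \<open>z\<close>, whereas bounds on the derivative near 0 depend on \<open>z\<close>.\<close>

lemma has_vector_derivative_integral_of_remainder:
  fixes F :: "real \<Rightarrow> real \<Rightarrow> complex"
  assumes F: "\<And>y. integrable M (F y)" and F': "integrable M F'" and w: "integrable M w"
    and rem: "\<And>d x. \<bar>d\<bar> \<le> 1 \<Longrightarrow> norm (F (z + d) x - F z x - d *\<^sub>R F' x) \<le> \<bar>d\<bar> * w x"
    and deriv: "\<And>x. ((\<lambda>y. F y x) has_vector_derivative F' x) (at z)"
  shows "((\<lambda>y. CLINT x|M. F y x) has_vector_derivative (CLINT x|M. F' x)) (at z)"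
proof -
  have [measurable]: "F y \<in> borel_measurable M" "F' \<in> borel_measurable M" for y
    using F F' by auto
  define R where "R d x = F (z + d) x - F z x - d *\<^sub>R F' x" for d x
  have R: "(CLINT x|M. R d x) = (CLINT x|M. F (z + d) x) - (CLINT x|M. F z x) - d *\<^sub>R (CLINT x|M. F' x)" for d
    using F F' by (simp add: R_def)
  have "((\<lambda>d. norm (CLINT x|M. R d x) / norm d) \<longlongrightarrow> 0) (at 0)"
    unfolding tendsto_at_iff_sequentially comp_def
  proof (intro allI impI)
    fix X :: "nat \<Rightarrow> real" assume X: "\<forall>i. X i \<in> UNIV - {0}" "X \<longlonglongrightarrow> 0"
    have "\<forall>\<^sub>F n in sequentially. norm (X n) < 1"
      using tendsto_norm[OF X(2)] by (rule order_tendstoD) simp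
    then obtain N where N: "\<And>n. N \<le> n \<Longrightarrow> \<bar>X n\<bar> \<le> 1"
      unfolding eventually_sequentially by force
    have "(\<lambda>n. CLINT x|M. (1 / X (n + N)) *\<^sub>R R (X (n + N)) x) \<longlonglongrightarrow> (CLINT x|M. 0)"
    proof (rule integral_dominated_convergence[OF _ _ w])
      show "(\<lambda>x. (1 / X (n + N)) *\<^sub>R R (X (n + N)) x) \<in> borel_measurable M" for n
        unfolding R_def by measurable
      show "AE x in M. norm ((1 / X (n + N)) *\<^sub>R R (X (n + N)) x) \<le> w x" for n
      proof (rule AE_I2)
        fix x
        have "0 < \<bar>X (n + N)\<bar>" using X(1) by auto
        then show "norm ((1 / X (n + N)) *\<^sub>R R (X (n + N)) x) \<le> w x"
          using rem[OF N[of "n + N"], of x] by (simp add: R_def divide_simps mult.commute)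
      qed
      show "AE x in M. (\<lambda>n. (1 / X (n + N)) *\<^sub>R R (X (n + N)) x) \<longlonglongrightarrow> 0"
      proof (rule AE_I2)
        fix x
        have "((\<lambda>d. norm (R d x) / norm d) \<longlongrightarrow> 0) (at 0)"
          using deriv[of x] by (simp add: has_vector_derivative_def has_derivative_at R_def)
        then have "(\<lambda>n. norm (R (X n) x) / norm (X n)) \<longlonglongrightarrow> 0"
          using X by (simp add: tendsto_at_iff_sequentially comp_def)
        then have "(\<lambda>n. norm ((1 / X n) *\<^sub>R R (X n) x)) \<longlonglongrightarrow> 0" by (simp add: abs_divide)
        from LIMSEQ_ignore_initial_segment[OF tendsto_norm_zero_cancel[OF this], of N]
        show "(\<lambda>n. (1 / X (n + N)) *\<^sub>R R (X (n + N)) x) \<longlonglongrightarrow> 0" .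
      qed
    qed simp
    from tendsto_norm[OF this]
    have "(\<lambda>n. norm (CLINT x|M. R (X (n + N)) x) / norm (X (n + N))) \<longlonglongrightarrow> 0"
      by (simp add: abs_divide)
    then show "(\<lambda>n. norm (CLINT x|M. R (X n) x) / norm (X n)) \<longlonglongrightarrow> 0"
      by (rule LIMSEQ_offset)
  qed
  then show ?thesis
    unfolding has_vector_derivative_def has_derivative_at R
    by (intro conjI bounded_linear_scaleR_left)
qed

lemma has_vector_derivative_iexp_mult:
  "((\<lambda>z. iexp (z * x)) has_vector_derivative \<i> * of_real x * iexp (z * x)) (at z)"
proof -
  have "((\<lambda>z. z * x) has_vector_derivative x) (at z)"
    using DERIV_cmult_right[OF DERIV_ident, of x z]
    by (simp add: has_real_derivative_iff_has_vector_derivative)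
  from vector_diff_chain_at[OF this has_vector_derivative_iexp] show ?thesis
    by (simp add: comp_def scaleR_conv_of_real mult_ac)
qed

lemma integrable_square_levy:
  assumes U: "levy_measure U" and fin: "finite_second_moment_at_infinity U"
  shows "integrable U (\<lambda>x. x\<^sup>2)"
proof -
  have s: "sets U = sets borel" using U by (simp add: levy_measure_def)
  note [measurable_cong] = s
  have "(\<integral>\<^sup>+x. ennreal (x\<^sup>2) \<partial>U)
    \<le> (\<integral>\<^sup>+x. ennreal (min 1 (x\<^sup>2)) + ennreal (x\<^sup>2) * indicator {x. \<bar>x\<bar> > 1} x \<partial>U)"
  proof (rule nn_integral_mono)
    fix x :: real
    have "x\<^sup>2 \<le> 1" if "\<not> \<bar>x\<bar> > 1" using that by (simp add: abs_square_le_1)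
    then show "ennreal (x\<^sup>2) \<le> ennreal (min 1 (x\<^sup>2)) + ennreal (x\<^sup>2) * indicator {x. \<bar>x\<bar> > 1} x"
      by (auto simp: indicator_def min_def add_increasing)
  qed
  also have "\<dots> = (\<integral>\<^sup>+x. ennreal (min 1 (x\<^sup>2)) \<partial>U) + (\<integral>\<^sup>+x\<in>{x. \<bar>x\<bar> > 1}. ennreal (x\<^sup>2) \<partial>U)"
    by (rule nn_integral_add) auto
  also have "\<dots> < \<infinity>"
    using U fin by (simp add: levy_measure_def finite_second_moment_at_infinity_def)
  finally show ?thesis by (intro integrableI_nonneg) auto
qed

text \<open>Both remainders contain \<open>exp (i d x) - 1 - i d x\<close>, at most \<open>(d x)\<^sup>2 / 2\<close> and at most \<open>2 \<bar>d x\<bar>\<close>.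
  The quadratic bound serves the first derivative; in the second the additional factor \<open>x\<close> makes
  the linear one sufficient. Either way a multiple of \<open>x\<^sup>2\<close> dominates.\<close>

lemma second_derivative_cumulant:
  assumes U: "levy_measure U" and h: "truncation_function h"
    and fin: "finite_second_moment_at_infinity U"
  shows "second_derivative (cumulant \<gamma> \<sigma> h U) z + of_real (\<sigma>\<^sup>2)
    = - (CLINT x|U. of_real (x\<^sup>2) * iexp (z * x))"
proof -
  have s: "sets U = sets borel" using U by (simp add: levy_measure_def)
  note [measurable_cong] = s
  have [measurable]: "h \<in> borel_measurable borel" using h by (simp add: truncation_function_def)
  note sq = integrable_square_levy[OF U fin]
  from h obtain C where C: "0 \<le> C" "\<And>x. \<bar>x * h x\<bar> \<le> C" "\<And>x. \<bar>x - x * h x\<bar> \<le> C * x\<^sup>2"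
    by (rule truncation_function_bounds) blast
  define I1 where "I1 z x = \<i> * of_real x * iexp (z * x) - \<i> * of_real (x * h x)" for z x
  define I2 where "I2 z x = - (of_real (x\<^sup>2) * iexp (z * x))" for z x
  have int1: "integrable U (I1 z)" for z
  proof (rule Bochner_Integration.integrable_bound)
    show "integrable U (\<lambda>x. (\<bar>z\<bar> + C) * x\<^sup>2)" using sq by simp
    show "I1 z \<in> borel_measurable U" unfolding I1_def by measurable
    have "norm (I1 z x) \<le> (\<bar>z\<bar> + C) * x\<^sup>2" for x
    proof -
      have "I1 z x = \<i> * of_real x * (iexp (z * x) - 1) + \<i> * of_real (x - x * h x)"
        by (simp add: I1_def algebra_simps)
      then have "norm (I1 z x) \<le> norm (\<i> * of_real x * (iexp (z * x) - 1)) + norm (\<i> * of_real (x - x * h x))"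
        by (metis norm_triangle_ineq)
      also have "\<dots> = \<bar>x\<bar> * norm (iexp (z * x) - 1) + \<bar>x - x * h x\<bar>"
        by (simp only: norm_mult norm_ii norm_of_real mult_1)
      also have "\<dots> \<le> \<bar>x\<bar> * \<bar>z * x\<bar> + C * x\<^sup>2"
        using iexp_approx1[of "z * x" 0] C(3)[of x] by (intro add_mono mult_left_mono) auto
      also have "\<dots> = (\<bar>z\<bar> + C) * x\<^sup>2" by (simp add: abs_mult power2_eq_square algebra_simps)
      finally show ?thesis .
    qed
    then show "AE x in U. norm (I1 z x) \<le> norm ((\<bar>z\<bar> + C) * x\<^sup>2)"
      by (intro AE_I2) (metis abs_ge_self order_trans real_norm_def)
  qed
  have int2: "integrable U (I2 z)" for z
  proof (rule Bochner_Integration.integrable_bound[OF sq])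
    show "I2 z \<in> borel_measurable U" unfolding I2_def by measurable
  qed (simp add: I2_def norm_mult norm_power del: of_real_mult)
  have D0: "((\<lambda>z. CLINT x|U. levy_integrand h z x) has_vector_derivative (CLINT x|U. I1 z x)) (at z)" for z
  proof (rule has_vector_derivative_integral_of_remainder[OF integrable_levy_integrand[OF U h] int1 sq])
    fix d x :: real assume d: "\<bar>d\<bar> \<le> 1"
    have "levy_integrand h (z + d) x - levy_integrand h z x - d *\<^sub>R I1 z x
      = iexp (z * x) * (iexp (d * x) - (1 + \<i> * of_real (d * x)))"
      by (simp add: levy_integrand_def I1_def scaleR_conv_of_real exp_add algebra_simps)
    then have "norm (levy_integrand h (z + d) x - levy_integrand h z x - d *\<^sub>R I1 z x)
      = norm (iexp (d * x) - (1 + \<i> * of_real (d * x)))"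
      by (simp only: norm_mult norm_exp_i_times mult_1)
    also have "\<dots> \<le> \<bar>d * x\<bar>^2 / 2"
      using iexp_approx1[of "d * x" 1] by (simp add: numeral_2_eq_2)
    also have "\<dots> = (\<bar>d\<bar> * \<bar>d\<bar>) * (x\<^sup>2 / 2)" by (simp add: power2_eq_square)
    also have "\<dots> \<le> (\<bar>d\<bar> * 1) * x\<^sup>2" using d by (intro mult_mono) auto
    finally show "norm (levy_integrand h (z + d) x - levy_integrand h z x - d *\<^sub>R I1 z x) \<le> \<bar>d\<bar> * x\<^sup>2"
      by simp
  next
    fix x
    show "((\<lambda>z. levy_integrand h z x) has_vector_derivative I1 z x) (at z)"
    proof -
      have "((\<lambda>z. z * x * h x) has_field_derivative x * h x) (at z)"
        by (auto intro!: derivative_eq_intros)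
      from has_vector_derivative_mult_right[OF has_vector_derivative_of_real[OF this], of \<i>]
        has_vector_derivative_iexp_mult[of x z]
      have "((\<lambda>z. iexp (z * x) - 1 - \<i> * of_real (z * x * h x)) has_vector_derivative
          \<i> * of_real x * iexp (z * x) - 0 - \<i> * of_real (x * h x)) (at z)"
        by (intro has_vector_derivative_diff has_vector_derivative_const)
      then show ?thesis by (simp only: levy_integrand_def I1_def diff_0_right)
    qed
  qed
  have D1: "((\<lambda>z. CLINT x|U. I1 z x) has_vector_derivative (CLINT x|U. I2 z x)) (at z)" for z
  proof (rule has_vector_derivative_integral_of_remainder[OF int1 int2])
    show "integrable U (\<lambda>x. 2 * x\<^sup>2)" using sq by simp
    fix d x :: real
    have "I1 (z + d) x - I1 z x - d *\<^sub>R I2 z x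
      = \<i> * of_real x * iexp (z * x) * (iexp (d * x) - (1 + \<i> * of_real (d * x)))"
      by (simp add: I1_def I2_def scaleR_conv_of_real exp_add power2_eq_square algebra_simps)
    then have "norm (I1 (z + d) x - I1 z x - d *\<^sub>R I2 z x)
      = \<bar>x\<bar> * norm (iexp (d * x) - (1 + \<i> * of_real (d * x)))"
      by (simp only: norm_mult norm_exp_i_times norm_ii norm_of_real mult_1 mult_1_right)
    also have "\<dots> \<le> \<bar>x\<bar> * (2 * \<bar>d * x\<bar>)"
      using iexp_approx2[of "d * x" 1] by (intro mult_left_mono) auto
    also have "\<dots> = \<bar>d\<bar> * (2 * x\<^sup>2)" by (simp add: abs_mult power2_eq_square)
    finally show "norm (I1 (z + d) x - I1 z x - d *\<^sub>R I2 z x) \<le> \<bar>d\<bar> * (2 * x\<^sup>2)" .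
  next
    fix x
    show "((\<lambda>z. I1 z x) has_vector_derivative I2 z x) (at z)"
    proof -
      have "((\<lambda>z. \<i> * of_real x * iexp (z * x) - \<i> * of_real (x * h x)) has_vector_derivative
          \<i> * of_real x * (\<i> * of_real x * iexp (z * x)) - 0) (at z)"
        by (intro has_vector_derivative_diff has_vector_derivative_const
            has_vector_derivative_mult_right has_vector_derivative_iexp_mult)
      also have "\<i> * of_real x * (\<i> * of_real x * iexp (z * x)) - 0
          = (\<i> * \<i>) * (of_real x * of_real x * iexp (z * x))"
        by (simp only: mult_ac diff_0_right)
      also have "\<dots> = I2 z x" by (simp add: I2_def power2_eq_square)
      finally show ?thesis by (simp only: I1_def)
    qed
  qed
  define Q where "Q z = \<i> * of_real \<gamma> - of_real (\<sigma>\<^sup>2 * z)" for z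
  have P0: "((\<lambda>z. \<i> * of_real (\<gamma> * z) - of_real (\<sigma>\<^sup>2 * z\<^sup>2 / 2)) has_vector_derivative Q z) (at z)" for z
  proof -
    have "((\<lambda>z. \<gamma> * z) has_field_derivative \<gamma>) (at z)"
      "((\<lambda>z. \<sigma>\<^sup>2 * z\<^sup>2 / 2) has_field_derivative \<sigma>\<^sup>2 * z) (at z)"
      by (auto intro!: derivative_eq_intros)
    then show ?thesis
      unfolding Q_def
      by (intro has_vector_derivative_diff has_vector_derivative_mult_right has_vector_derivative_of_real)
  qed
  have P1: "(Q has_vector_derivative - of_real (\<sigma>\<^sup>2)) (at z)" for z
  proof -
    have "((\<lambda>z. \<sigma>\<^sup>2 * z) has_field_derivative \<sigma>\<^sup>2) (at z)"
      by (auto intro!: derivative_eq_intros)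
    then have "((\<lambda>z. \<i> * complex_of_real \<gamma> - of_real (\<sigma>\<^sup>2 * z)) has_vector_derivative 0 - of_real (\<sigma>\<^sup>2)) (at z)"
      by (intro has_vector_derivative_diff has_vector_derivative_const has_vector_derivative_of_real)
    then show ?thesis by (simp only: Q_def[abs_def] diff_0)
  qed
  have "(cumulant \<gamma> \<sigma> h U has_vector_derivative Q z + (CLINT x|U. I1 z x)) (at z)" for z
    unfolding cumulant_eq_levy_integrand[abs_def] by (rule has_vector_derivative_add[OF P0 D0])
  then have "vector_derivative (cumulant \<gamma> \<sigma> h U) (at z) = Q z + (CLINT x|U. I1 z x)" for z
    by (rule vector_derivative_at)
  then have "second_derivative (cumulant \<gamma> \<sigma> h U) z
      = vector_derivative (\<lambda>z. Q z + (CLINT x|U. I1 z x)) (at z)"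
    by (simp only: second_derivative_def)
  also have "\<dots> = - of_real (\<sigma>\<^sup>2) + (CLINT x|U. I2 z x)"
    by (rule vector_derivative_at, rule has_vector_derivative_add[OF P1 D1])
  also have "(CLINT x|U. I2 z x) = - (CLINT x|U. of_real (x\<^sup>2) * iexp (z * x))"
    unfolding I2_def by (rule Bochner_Integration.integral_minus)
  finally show ?thesis by simp
qed

section \<open>The weight (x - sin x) / x\<close>

text \<open>Strictness comes from \<open>sin x = 2 sin (x / 2) cos (x / 2) < 2 sin (x / 2) \<le> x\<close> below \<open>pi\<close>.\<close>

lemma sin_less_self:
  assumes "0 < x"
  shows "sin x < (x::real)"
proof (cases "x < pi")
  case True
  have "cos (x / 2) < 1"
    using assms True cos_monotone_0_pi[of 0 "x / 2"] by simp
  moreover have "0 < sin (x / 2)" using assms True by (intro sin_gt_zero) auto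
  moreover have "sin x = 2 * sin (x / 2) * cos (x / 2)"
    using sin_double[of "x / 2"] by simp
  moreover have "sin (x / 2) \<le> x / 2" using assms by (intro sin_x_le_x) simp
  ultimately show ?thesis
    using mult_strict_left_mono[of "cos (x / 2)" 1 "sin (x / 2)"] by linarith
next
  case False
  then show ?thesis using pi_ge_two sin_le_one[of x] by linarith
qed

lemma diff_sin_mono:
  assumes "x \<le> y"
  shows "x - sin x \<le> y - sin (y::real)"
  using assms
proof (rule DERIV_nonneg_imp_nondecreasing)
  fix t :: real
  show "\<exists>D. ((\<lambda>x. x - sin x) has_real_derivative D) (at t) \<and> 0 \<le> D"
    by (rule exI[of _ "1 - cos t"]) (auto intro!: derivative_eq_intros)
qed

lemma sinc_weight_abs: "sinc_weight \<bar>x\<bar> = sinc_weight x"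
  by (cases "0 \<le> x") (auto simp: sinc_weight_def abs_if divide_simps)

lemma sinc_weight_nonneg: "0 \<le> sinc_weight x"
  unfolding sinc_weight_abs[of x, symmetric] unfolding sinc_weight_def
  using sin_x_le_x[of "\<bar>x\<bar>"] by simp

lemma measurable_sinc_weight [measurable]: "sinc_weight \<in> borel_measurable borel"
  unfolding sinc_weight_def[abs_def] by measurable

lemma continuous_sinc_weight: "continuous_on (- {0}) sinc_weight"
  unfolding sinc_weight_def[abs_def] by (intro continuous_intros) auto

text \<open>For \<open>\<bar>x\<bar> \<ge> 2\<close> the quotient \<open>sin x / x\<close> is at most \<open>1 / 2\<close>; below 2 the numerator
  \<open>x - sin x\<close> increases with \<open>x\<close>.\<close>

lemma sinc_weight_lower:
  assumes "0 < \<epsilon>"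
  shows "\<exists>c>0. \<forall>x. \<epsilon> \<le> \<bar>x\<bar> \<longrightarrow> c \<le> sinc_weight x"
proof (intro exI conjI allI impI)
  show "0 < min 1 (\<epsilon> - sin \<epsilon>)" using sin_less_self[OF assms] by simp
  fix x assume x: "\<epsilon> \<le> \<bar>x\<bar>"
  define y where "y = \<bar>x\<bar>"
  have y: "\<epsilon> \<le> y" "0 < y" using x assms by (auto simp: y_def)
  have "min 1 (\<epsilon> - sin \<epsilon>) \<le> sinc_weight y"
  proof (cases "2 \<le> y")
    case True
    then have "2 * sin y \<le> y" using sin_le_one[of y] by linarith
    then have "1 \<le> sinc_weight y" using y by (simp add: sinc_weight_def field_simps)
    then show ?thesis by simp
  next
    case False
    have "(\<epsilon> - sin \<epsilon>) * y \<le> (y - sin y) * 2"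
      using diff_sin_mono[OF y(1)] False y sin_less_self[OF assms] by (intro mult_mono) auto
    then have "\<epsilon> - sin \<epsilon> \<le> sinc_weight y" using y by (simp add: sinc_weight_def field_simps)
    then show ?thesis by simp
  qed
  then show "min 1 (\<epsilon> - sin \<epsilon>) \<le> sinc_weight x" by (simp add: y_def sinc_weight_abs)
qed

text \<open>The quadratic bound is the cubic Taylor remainder of the sine divided by \<open>x\<close>.\<close>

lemma sinc_weight_upper: "sinc_weight x \<le> 4 * min 1 (x\<^sup>2)"
proof (cases "x = 0")
  case False
  define y where "y = \<bar>x\<bar>"
  have y: "0 < y" using False by (simp add: y_def)
  have "sinc_weight y \<le> 4"
  proof -
    have "- sin y \<le> y" using abs_sin_x_le_abs_x[of y] y by linarith
    then show ?thesis using y by (simp add: sinc_weight_def field_simps)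
  qed
  moreover have "sinc_weight y \<le> 4 * y\<^sup>2"
  proof -
    \<comment> \<open>The imaginary part of the second Taylor polynomial of iexp is y.\<close>
    have "y - sin y \<le> norm (iexp y - (1 + \<i> * y - y\<^sup>2 / 2))"
      using abs_Im_le_cmod[of "iexp y - (1 + \<i> * y - y\<^sup>2 / 2)"] by (simp add: Im_exp)
    also have "\<dots> \<le> y ^ 3 / 6"
      using iexp_approx1[of y 2] y
      by (simp add: numeral_3_eq_3 numeral_2_eq_2 power_mult_distrib fact_numeral algebra_simps)
    also have "\<dots> \<le> y ^ 3 * 2" using y by simp
    finally show ?thesis using y by (simp add: sinc_weight_def power2_eq_square power3_eq_cube field_simps)
  qed
  ultimately have "sinc_weight y \<le> 4 * min 1 (y\<^sup>2)" by (simp add: min_def)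
  then show ?thesis by (simp add: y_def sinc_weight_abs)
qed (simp add: sinc_weight_def)

lemma integrable_sinc_weight:
  assumes U: "levy_measure U"
  shows "integrable U sinc_weight"
  by (rule integrable_levy_bounded[OF U, of _ 4]) (use sinc_weight_nonneg sinc_weight_upper in auto)

section \<open>Weighted Levy measures\<close>

lemma finite_measure_density:
  fixes w :: "real \<Rightarrow> real"
  assumes w: "integrable U w"
  shows "finite_measure (density U w)"
proof
  have [measurable]: "w \<in> borel_measurable U" using w by auto
  have "emeasure (density U w) (space (density U w)) = (\<integral>\<^sup>+x. ennreal (w x) \<partial>U)"
    by (subst emeasure_density) (auto intro!: nn_integral_cong simp: indicator_def)
  also have "\<dots> \<le> (\<integral>\<^sup>+x. ennreal (norm (w x)) \<partial>U)"
    by (intro nn_integral_mono ennreal_leI) simp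
  also have "\<dots> < \<infinity>" using w by (simp add: integrable_iff_bounded)
  finally show "emeasure (density U w) (space (density U w)) \<noteq> \<infinity>" by simp
qed

lemma char_density:
  fixes w :: "real \<Rightarrow> real"
  assumes "sets U = sets borel" "integrable U w" "\<And>x. 0 \<le> w x"
  shows "char (density U w) z = (CLINT x|U. of_real (w x) * iexp (z * x))"
proof -
  note [measurable_cong] = assms(1)
  have [measurable]: "w \<in> borel_measurable U" using assms by auto
  show ?thesis
    unfolding char_def using assms(3)
    by (subst integral_density) (auto simp: scaleR_conv_of_real)
qed

lemma weighted_principal_value:
  fixes w :: "real \<Rightarrow> real"
  assumes U: "sets U = sets borel" and w: "integrable U w" "\<And>x. 0 \<le> w x" and ab: "a < b"
    and atoms: "emeasure U ({a} \<union> {b}) = 0"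
  shows "has_principal_value (\<lambda>z. char (density U w) z * interval_kernel a b z)
    (of_real (2 * pi * (LINT x:{a..b}|U. w x)))"
proof -
  note [measurable_cong] = U
  have [measurable]: "w \<in> borel_measurable U" using w by auto
  have sets: "{c} \<in> sets U" "{a..b} \<in> sets U" for c by (simp_all add: U)
  have "{a} \<union> {b} \<in> null_sets U" using atoms U by (simp add: null_sets_def)
  then have null: "{a} \<in> null_sets U" "{b} \<in> null_sets U"
    using sets by (auto intro: null_sets_subset)
  have 0: "measure (density U w) {c} = 0" if "{c} \<in> null_sets U" for c
  proof -
    have "emeasure (density U w) {c} = 0"
      using nn_integral_null_set[OF that, of "\<lambda>x. ennreal (w x)"] by (subst emeasure_density) (use sets in auto)
    then show ?thesis by (simp add: measure_def)
  qed
  have "emeasure (density U w) {a..b} = (\<integral>\<^sup>+x. ennreal (w x) * indicator {a..b} x \<partial>U)"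
    by (rule emeasure_density) (use sets in auto)
  also have "\<dots> = (\<integral>\<^sup>+x. ennreal (indicator {a..b} x *\<^sub>R w x) \<partial>U)"
    by (intro nn_integral_cong) (simp add: indicator_def)
  also have "\<dots> = ennreal (LINT x:{a..b}|U. w x)"
    unfolding set_lebesgue_integral_def
    using w(2) by (intro nn_integral_eq_integral integrable_mult_indicator sets w(1) AE_I2) simp
  finally have em: "emeasure (density U w) {a..b} = ennreal (LINT x:{a..b}|U. w x)" .
  have "0 \<le> (LINT x:{a..b}|U. w x)"
    unfolding set_lebesgue_integral_def
    by (rule Bochner_Integration.integral_nonneg) (use w(2) in simp)
  then have "measure (density U w) {a..b} = (LINT x:{a..b}|U. w x)"
    by (simp only: measure_def em enn2real_ennreal)
  moreover have "has_principal_value (\<lambda>z. char (density U w) z * interval_kernel a b z)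
      (of_real (2 * pi * measure (density U w) {a..b}))"
    using ab U by (intro char_principal_value finite_measure_density w(1) 0 null) auto
  ultimately show ?thesis by (simp only:)
qed

lemma has_principal_value_uminus:
  assumes "has_principal_value g L"
  shows "has_principal_value (\<lambda>z. - g z) (- L)"
proof -
  have g: "set_integrable lborel {-T..T} g" "((\<lambda>T. CLBINT z:{-T..T}. g z) \<longlongrightarrow> L) at_top" for T
    using assms by (simp_all only: has_principal_value_def)
  have "set_integrable lborel {-T..T} (\<lambda>z. - g z)" for T
    using g(1)[of T] by (simp add: set_integrable_def)
  moreover have "(CLBINT z:{-T..T}. - g z) = - (CLBINT z:{-T..T}. g z)" for T
    by (simp add: set_lebesgue_integral_def)
  ultimately show ?thesis
    unfolding has_principal_value_def using tendsto_minus[OF g(2)] by simp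
qed

theorem mainTheorem1:
  fixes \<gamma> \<sigma> a b :: real and h :: "real \<Rightarrow> real" and U P :: "real measure"
    and \<phi> \<psi> \<rho> :: "real \<Rightarrow> complex"
  assumes "\<sigma> \<ge> 0"
    and "levy_measure U"
    and "truncation_function h"
    and "\<And>z. \<psi> z = cumulant \<gamma> \<sigma> h U z"
    and "\<And>z. \<phi> z = exp (\<psi> z)"
    and "infinitely_divisible P"
    and "\<And>z. char P z = \<phi> z"
    and "\<And>z. \<rho> z = rho_hat \<psi> \<sigma> z"
    and "a < b"
    and "emeasure U ({a} \<union> {b}) = 0"
  shows
    "(\<exists>L::complex. has_principal_value (\<lambda>z. \<rho> z * (CLBINT x:{a..b}. iexp (- (z * x)))) L \<and>
        complex_of_real (LINT x:{a..b}|U. (x - sin x) / x) = of_real (1 / (4 * pi)) * L) \<and>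
     (finite_second_moment_at_infinity U \<longrightarrow>
       (\<exists>L::complex. has_principal_value
              (\<lambda>z. (second_derivative \<psi> z + of_real (\<sigma>\<^sup>2)) *
                (CLBINT x:{a..b}. iexp (- (z * x)))) L \<and>
          complex_of_real (LINT x:{a..b}|U. x\<^sup>2) = - of_real (1 / (2 * pi)) * L)) \<and>
     (integrable lborel \<rho> \<longrightarrow>
       absolutely_continuous lborel U \<and>
       (\<exists>u. lebesgue_density U u \<and> bounded_continuous_off_zero u \<and>
         (\<forall>x. x \<noteq> 0 \<longrightarrow> complex_of_real (u x) =
            of_real (x / (x - sin x) * (1 / (4 * pi))) *
              (CLBINT z. iexp (- (z * x)) * \<rho> z)))) \<and>
     (finite_second_moment_at_infinity U \<and>
      integrable lborel (\<lambda>z. second_derivative \<psi> z + of_real (\<sigma>\<^sup>2)) \<longrightarrow>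
       absolutely_continuous lborel U \<and>
       (\<exists>u. lebesgue_density U u \<and> bounded_continuous_off_zero u \<and>
         (\<forall>x. x \<noteq> 0 \<longrightarrow> complex_of_real (u x) =
            - of_real (1 / (2 * pi * x\<^sup>2)) *
              (CLBINT z. iexp (- (z * x)) * (second_derivative \<psi> z + of_real (\<sigma>\<^sup>2))))))"
proof -
  note U = \<open>levy_measure U\<close> and h = \<open>truncation_function h\<close>
  have s: "sets U = sets borel" and U0: "emeasure U {0} = 0"
    using U by (auto simp: levy_measure_def)
  have \<psi>: "\<psi> = cumulant \<gamma> \<sigma> h U" using assms(4) by auto
  let ?M = "density U sinc_weight" and ?N = "density U (\<lambda>x. x\<^sup>2)"
  note sinc = integrable_sinc_weight[OF U] sinc_weight_nonneg
  have \<rho>: "\<rho> = char ?M"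
    using assms(8) by (auto simp: \<psi> rho_hat_cumulant[OF U h] char_density[OF s sinc])
  have \<psi>'': "second_derivative \<psi> z + of_real (\<sigma>\<^sup>2) = - char ?N z"
    if "finite_second_moment_at_infinity U" for z
    unfolding \<psi> second_derivative_cumulant[OF U h that]
    using integrable_square_levy[OF U that] by (subst char_density[OF s]) auto
  show ?thesis
    unfolding interval_kernel_def[symmetric]
  proof (intro conjI[of "Ex _"] conjI[of "_ \<longrightarrow> _"] impI)
    show "\<exists>L. has_principal_value (\<lambda>z. \<rho> z * interval_kernel a b z) L \<and>
        complex_of_real (LINT x:{a..b}|U. (x - sin x) / x) = of_real (1 / (4 * pi)) * L"
    proof (intro exI conjI)
      show "has_principal_value (\<lambda>z. \<rho> z * interval_kernel a b z)
          (of_real (2 * pi * (LINT x:{a..b}|U. sinc_weight x)))"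
        unfolding \<rho> by (rule weighted_principal_value[OF s sinc assms(9,10)])
    qed (simp add: sinc_weight_def del: times_divide_eq_right)
  next
    assume fin: "finite_second_moment_at_infinity U"
    show "\<exists>L. has_principal_value
          (\<lambda>z. (second_derivative \<psi> z + of_real (\<sigma>\<^sup>2)) * interval_kernel a b z) L \<and>
        complex_of_real (LINT x:{a..b}|U. x\<^sup>2) = - of_real (1 / (2 * pi)) * L"
    proof (intro exI conjI)
      have "has_principal_value (\<lambda>z. - (char ?N z * interval_kernel a b z))
          (- of_real (2 * pi * (LINT x:{a..b}|U. x\<^sup>2)))"
        by (intro has_principal_value_uminus weighted_principal_value s
            integrable_square_levy[OF U fin] assms(9,10)) simp
      then show "has_principal_value
          (\<lambda>z. (second_derivative \<psi> z + of_real (\<sigma>\<^sup>2)) * interval_kernel a b z)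
          (- of_real (2 * pi * (LINT x:{a..b}|U. x\<^sup>2)))"
        unfolding \<psi>''[OF fin] by simp
    qed simp
  next
    assume int: "integrable lborel \<rho>"
    have eq: "of_real (x / (x - sin x) * (1 / (4 * pi))) * (CLBINT z. iexp (- (z * x)) * \<rho> z)
      = of_real (1 / (2 * pi * sinc_weight x)) * inverse_fourier (char ?M) x" for x
      by (simp add: \<rho> inverse_fourier_def sinc_weight_def)
    show "absolutely_continuous lborel U \<and>
       (\<exists>u. lebesgue_density U u \<and> bounded_continuous_off_zero u \<and>
         (\<forall>x. x \<noteq> 0 \<longrightarrow> complex_of_real (u x) =
            of_real (x / (x - sin x) * (1 / (4 * pi))) * (CLBINT z. iexp (- (z * x)) * \<rho> z)))"
      unfolding eq
      by (rule levy_density_of_integrable_char[OF s U0 measurable_sinc_weight sinc_weight_nonneg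
          continuous_sinc_weight sinc_weight_lower finite_measure_density[OF sinc(1)] int[unfolded \<rho>]])
  next
    assume "finite_second_moment_at_infinity U \<and>
      integrable lborel (\<lambda>z. second_derivative \<psi> z + of_real (\<sigma>\<^sup>2))"
    then have fin: "finite_second_moment_at_infinity U"
      and "integrable lborel (\<lambda>z. - char ?N z)"
      using \<psi>'' by auto
    from integrable_minus[OF this(2)] have int: "integrable lborel (char ?N)" by simp
    have eq: "- of_real (1 / (2 * pi * x\<^sup>2)) *
        (CLBINT z. iexp (- (z * x)) * (second_derivative \<psi> z + of_real (\<sigma>\<^sup>2)))
      = of_real (1 / (2 * pi * x\<^sup>2)) * inverse_fourier (char ?N) x" for x
      unfolding \<psi>''[OF fin] by (simp add: inverse_fourier_def)
    have lower: "\<exists>c>0. \<forall>x. \<epsilon> \<le> \<bar>x\<bar> \<longrightarrow> c \<le> x\<^sup>2" if "0 < \<epsilon>" for \<epsilon> :: real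
    proof (intro exI[of _ "\<epsilon>\<^sup>2"] conjI allI impI)
      fix x assume "\<epsilon> \<le> \<bar>x\<bar>"
      then show "\<epsilon>\<^sup>2 \<le> x\<^sup>2" using power_mono[of \<epsilon> "\<bar>x\<bar>" 2] that by simp
    qed (use that in simp)
    have cont: "continuous_on (- {0}) (\<lambda>x::real. x\<^sup>2)" by (intro continuous_intros)
    show "absolutely_continuous lborel U \<and>
       (\<exists>u. lebesgue_density U u \<and> bounded_continuous_off_zero u \<and>
         (\<forall>x. x \<noteq> 0 \<longrightarrow> complex_of_real (u x) =
            - of_real (1 / (2 * pi * x\<^sup>2)) *
              (CLBINT z. iexp (- (z * x)) * (second_derivative \<psi> z + of_real (\<sigma>\<^sup>2)))))"
      unfolding eq
      by (rule levy_density_of_integrable_char[OF s U0 _ _ cont lower finite_measure_density[OF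
          integrable_square_levy[OF U fin]] int]) auto
  qed
qed

end
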